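(* Let $n\ge 7$. If $G$ and $H$ are graphs on $n$ vertices with the same $(n-3)$-deck, i.e. $\mathcal{D}_{n-3}(G)=\mathcal{D}_{n-3}(H)$, then $G$ and $H$ have the same degree list (multiset of vertex degrees). Moreover, the threshold on $n$ is sharp: there exist two graphs on $6$ vertices with the same $3$-deck but different degree lists.
   Context: All graphs are finite and simple. For a graph $G$, a $k$-card of $G$ is an induced subgraph of $G$ on $k$ vertices, considered up to isomorphism. The $k$-deck $\mathcal{D}_k(G)$ is the multiset of all $k$-cards of $G$ (one for each $k$-element vertex subset). *)

theory Defs
  imports Main "HOL-Library.Multiset"
begin

definition simple_graph :: "'a set \<Rightarrow> 'a set set \<Rightarrow> bool" where
  "simple_graph V E \<longleftrightarrow> finite V \<and> (\<forall>e\<in>E. e \<subseteq> V \<and> card e = 2)"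

definition graph_iso :: "'a set \<Rightarrow> 'a set set \<Rightarrow> 'b set \<Rightarrow> 'b set set \<Rightarrow> bool" where
  "graph_iso V E W F \<longleftrightarrow>
     (\<exists>f. bij_betw f V W \<and> (\<forall>u\<in>V. \<forall>v\<in>V. {u, v} \<in> E \<longleftrightarrow> {f u, f v} \<in> F))"

definition induced :: "'a set set \<Rightarrow> 'a set \<Rightarrow> 'a set set" where
  "induced E S = {e \<in> E. e \<subseteq> S}"

text \<open>Isomorphism class of a graph, represented canonically as the set of all
  simple graphs on the vertex set {0..<card V} isomorphic to it.\<close>
definition iso_class :: "'a set \<Rightarrow> 'a set set \<Rightarrow> nat set set set" where
  "iso_class V E = {F. simple_graph {0..<card V} F \<and> graph_iso {0..<card V} F V E}"

definition deck :: "nat \<Rightarrow> 'a set \<Rightarrow> 'a set set \<Rightarrow> nat set set set multiset" where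
  "deck k V E = image_mset (\<lambda>S. iso_class S (induced E S)) (mset_set {S. S \<subseteq> V \<and> card S = k})"

definition degree :: "'a set set \<Rightarrow> 'a \<Rightarrow> nat" where
  "degree E v = card {e \<in> E. v \<in> e}"

definition degree_list :: "'a set \<Rightarrow> 'a set set \<Rightarrow> nat multiset" where
  "degree_list V E = image_mset (degree E) (mset_set V)"

end

theory Submission
  imports Defs Complex_Main
begin

text \<open>Put \<open>N = n - 1\<close> and let \<open>x d\<close> be the difference of the numbers of vertices of degree \<open>d\<close> in \<open>G\<close>
  and \<open>H\<close>. Counting the vertices of degree \<open>t\<close> over all cards shows that \<open>x\<close> is orthogonal to all
  polynomials of degree at most \<open>N - 3\<close>, hence \<open>x d = (-1)^d (N choose d) q d\<close> for a quadratic \<open>q\<close>.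
  Since the absolute values of the integers \<open>x d\<close> add up to at most \<open>2 n\<close>, whereas the binomial
  coefficients in the middle are large, \<open>x\<close> vanishes when \<open>n \<ge> 8\<close>.

  For \<open>n = 7\<close> three vectors survive up to sign. One of them would give a graph with both an isolated
  and a dominating vertex. In the other two cases the degrees force one of the graphs to be a split
  graph: a 4-clique and an independent 4-set sharing one vertex. Both are cards, so the other graph
  has the same structure, which its degrees do not allow.\<close>

section \<open>Cards and isomorphism classes\<close>

definition neighbours :: "'a set set \<Rightarrow> 'a \<Rightarrow> 'a set" where
  "neighbours E v = {u. {u, v} \<in> E}"

lemma neighbours_sym: "u \<in> neighbours E v \<longleftrightarrow> v \<in> neighbours E u"
  by (simp add: neighbours_def insert_commute)

lemma neighbours_subset:
  assumes "simple_graph V E"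
  shows "neighbours E v \<subseteq> V - {v}"
proof
  fix u assume "u \<in> neighbours E v"
  then have "{u, v} \<subseteq> V" "card {u, v} = 2"
    using assms by (auto simp: neighbours_def simple_graph_def)
  then show "u \<in> V - {v}" by auto
qed

lemma finite_neighbours: "simple_graph V E \<Longrightarrow> finite (neighbours E v)"
  using neighbours_subset[of V E v] by (auto simp: simple_graph_def intro: finite_subset)

lemma degree_eq_card_neighbours:
  assumes "simple_graph V E"
  shows "degree E v = card (neighbours E v)"
proof -
  have "bij_betw (\<lambda>u. {u, v}) (neighbours E v) {e \<in> E. v \<in> e}"
  proof (rule bij_betwI')
    fix x y assume "x \<in> neighbours E v" "y \<in> neighbours E v"
    then show "({x, v} = {y, v}) = (x = y)"
      using neighbours_subset[OF assms, of v] by (auto simp: doubleton_eq_iff)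
  next
    fix x assume "x \<in> neighbours E v"
    then show "{x, v} \<in> {e \<in> E. v \<in> e}" by (simp add: neighbours_def)
  next
    fix e assume e: "e \<in> {e \<in> E. v \<in> e}"
    then have "card e = 2" using assms by (auto simp: simple_graph_def)
    then obtain a b where "e = {a, b}" by (auto simp: card_2_iff)
    then show "\<exists>x\<in>neighbours E v. e = {x, v}"
      using e by (auto simp: neighbours_def insert_commute)
  qed
  then show ?thesis by (simp add: degree_def bij_betw_same_card)
qed

lemma degree_le:
  assumes "simple_graph V E" "v \<in> V"
  shows "degree E v \<le> card V - 1"
proof -
  have "card (neighbours E v) \<le> card (V - {v})"
    using neighbours_subset[OF assms(1)] assms(1) by (intro card_mono) (auto simp: simple_graph_def)
  then show ?thesis using assms(2) by (simp add: degree_eq_card_neighbours[OF assms(1)])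
qed

lemma simple_graph_induced:
  "simple_graph V E \<Longrightarrow> S \<subseteq> V \<Longrightarrow> simple_graph S (induced E S)"
  by (auto simp: simple_graph_def induced_def intro: finite_subset)

lemma degree_induced:
  assumes "simple_graph V E" "S \<subseteq> V" "v \<in> S"
  shows "degree (induced E S) v = card (neighbours E v \<inter> S)"
proof -
  have "neighbours (induced E S) v = neighbours E v \<inter> S"
    using assms(3) by (auto simp: neighbours_def induced_def)
  then show ?thesis
    using degree_eq_card_neighbours[OF simple_graph_induced[OF assms(1,2)]] by simp
qed

section \<open>Isomorphism as an equivalence, and what it preserves\<close>

lemma graph_iso_sym:
  assumes "graph_iso V E W F"
  shows "graph_iso W F V E"
proof -
  obtain f where f: "bij_betw f V W" "\<And>u v. u \<in> V \<Longrightarrow> v \<in> V \<Longrightarrow> {u, v} \<in> E \<longleftrightarrow> {f u, f v} \<in> F"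
    using assms by (auto simp: graph_iso_def)
  let ?g = "the_inv_into V f"
  have g: "bij_betw ?g W V" using f(1) by (rule bij_betw_the_inv_into)
  have "{u, v} \<in> F \<longleftrightarrow> {?g u, ?g v} \<in> E" if "u \<in> W" "v \<in> W" for u v
    using f(2)[of "?g u" "?g v"] that g f(1) by (simp add: bij_betw_apply f_the_inv_into_f_bij_betw)
  then show ?thesis using g by (auto simp: graph_iso_def)
qed

lemma graph_iso_trans:
  assumes "graph_iso V E W F" "graph_iso W F X G"
  shows "graph_iso V E X G"
proof -
  obtain f where f: "bij_betw f V W" "\<And>u v. u \<in> V \<Longrightarrow> v \<in> V \<Longrightarrow> {u, v} \<in> E \<longleftrightarrow> {f u, f v} \<in> F"
    using assms(1) by (auto simp: graph_iso_def)
  obtain g where g: "bij_betw g W X" "\<And>u v. u \<in> W \<Longrightarrow> v \<in> W \<Longrightarrow> {u, v} \<in> F \<longleftrightarrow> {g u, g v} \<in> G"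
    using assms(2) by (auto simp: graph_iso_def)
  have "bij_betw (g \<circ> f) V X" using f(1) g(1) by (rule bij_betw_trans)
  moreover have "{u, v} \<in> E \<longleftrightarrow> {(g \<circ> f) u, (g \<circ> f) v} \<in> G" if "u \<in> V" "v \<in> V" for u v
    using f g that by (simp add: bij_betw_apply)
  ultimately show ?thesis unfolding graph_iso_def by blast
qed

lemma graph_iso_degree_list:
  assumes "graph_iso V E W F" "simple_graph V E" "simple_graph W F"
  shows "degree_list V E = degree_list W F"
proof -
  obtain f where f: "bij_betw f V W" "\<And>u v. u \<in> V \<Longrightarrow> v \<in> V \<Longrightarrow> {u, v} \<in> E \<longleftrightarrow> {f u, f v} \<in> F"
    using assms by (auto simp: graph_iso_def)
  have deg: "degree E v = degree F (f v)" if v: "v \<in> V" for v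
  proof -
    have "f ` neighbours E v = neighbours F (f v)"
    proof (intro equalityI subsetI)
      fix y assume "y \<in> f ` neighbours E v"
      then show "y \<in> neighbours F (f v)"
        using f(2) v neighbours_subset[OF assms(2)] by (fastforce simp: neighbours_def)
    next
      fix y assume y: "y \<in> neighbours F (f v)"
      then have "y \<in> W" using neighbours_subset[OF assms(3)] by blast
      then obtain u where "u \<in> V" "y = f u" using f(1) by (auto simp: bij_betw_def)
      then show "y \<in> f ` neighbours E v" using y f(2) v by (auto simp: neighbours_def)
    qed
    moreover have "inj_on f (neighbours E v)"
      using f(1) neighbours_subset[OF assms(2), of v] by (auto simp: bij_betw_def intro: inj_on_subset)
    ultimately show ?thesis
      using degree_eq_card_neighbours[OF assms(2)] degree_eq_card_neighbours[OF assms(3)]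
      by (metis card_image)
  qed
  have "degree_list W F = image_mset (degree F) (image_mset f (mset_set V))"
    using f(1) by (simp add: degree_list_def bij_betw_def image_mset_mset_set)
  also have "\<dots> = degree_list V E"
    using assms(2) by (auto simp: degree_list_def image_mset.compositionality deg simple_graph_def intro!: image_mset_cong)
  finally show ?thesis by simp
qed

text \<open>Pulling the edges back along an enumeration of \<open>V\<close> gives a member. This is
  what allows a representative to be chosen from a class by \<open>SOME\<close>.\<close>

lemma iso_class_nonempty:
  assumes "simple_graph V E"
  shows "iso_class V E \<noteq> {}"
proof -
  have "finite V" using assms by (simp add: simple_graph_def)
  then obtain f where f: "bij_betw f {0..<card V} V" using ex_bij_betw_nat_finite by blast
  define F where "F = {e. e \<subseteq> {0..<card V} \<and> f ` e \<in> E}"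
  have "card e = 2" if "e \<in> F" for e
  proof -
    have "card e = card (f ` e)"
      using that f by (metis (no_types, lifting) F_def bij_betw_def card_image inj_on_subset mem_Collect_eq)
    then show ?thesis using that assms by (auto simp: F_def simple_graph_def)
  qed
  then have "simple_graph {0..<card V} F" by (auto simp: simple_graph_def F_def)
  moreover have "graph_iso {0..<card V} F V E"
    unfolding graph_iso_def using f by (intro exI[of _ f]) (auto simp: F_def)
  ultimately show ?thesis by (auto simp: iso_class_def)
qed

lemma iso_class_eqI:
  assumes "graph_iso V E W F"
  shows "iso_class V E = iso_class W F"
proof -
  have "card V = card W" using assms by (auto simp: graph_iso_def bij_betw_same_card)
  moreover have "graph_iso X G V E \<longleftrightarrow> graph_iso X G W F" for X :: "nat set" and G
    using assms graph_iso_sym graph_iso_trans by metis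
  ultimately show ?thesis by (simp add: iso_class_def)
qed

text \<open>A common member exists because the class is nonempty, and it links the two graphs. So
  membership of a class in a deck can be turned into an actual card.\<close>

lemma iso_class_eqD:
  assumes "iso_class V E = iso_class W F" "simple_graph V E" "card V = card W"
  shows "graph_iso V E W F"
proof -
  obtain X where "X \<in> iso_class V E" using iso_class_nonempty[OF assms(2)] by blast
  then have X: "graph_iso {0..<card V} X V E" "graph_iso {0..<card V} X W F"
    using assms by (auto simp: iso_class_def)
  show ?thesis using graph_iso_trans[OF graph_iso_sym[OF X(1)] X(2)] .
qed

abbreviation subsets_of_card :: "nat \<Rightarrow> 'a set \<Rightarrow> 'a set set" where
  "subsets_of_card k V \<equiv> {S. S \<subseteq> V \<and> card S = k}"

text \<open>The degree list is an isomorphism invariant, so it can be read off from any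
  representative of the class. The right-hand side is thus a function of the deck alone.\<close>

lemma deck_degree_lists:
  assumes "simple_graph V E"
  shows "image_mset (\<lambda>S. degree_list S (induced E S)) (mset_set (subsets_of_card k V))
       = image_mset (\<lambda>c. degree_list {0..<k} (SOME X. X \<in> c)) (deck k V E)"
proof -
  have "degree_list S (induced E S) = degree_list {0..<k} (SOME X. X \<in> iso_class S (induced E S))"
    if "S \<subseteq> V" "card S = k" for S
  proof -
    have S: "simple_graph S (induced E S)" using simple_graph_induced[OF assms that(1)] .
    let ?X = "SOME X. X \<in> iso_class S (induced E S)"
    have "?X \<in> iso_class S (induced E S)" using iso_class_nonempty[OF S] by (simp add: some_in_eq)
    then have "simple_graph {0..<k} ?X" "graph_iso {0..<k} ?X S (induced E S)"
      using that(2) by (auto simp: iso_class_def)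
    then show ?thesis using graph_iso_degree_list S by metis
  qed
  moreover have "finite (subsets_of_card k V)" using assms by (simp add: simple_graph_def)
  ultimately show ?thesis
    by (auto simp: deck_def image_mset.compositionality intro!: image_mset_cong)
qed

text \<open>Moves one card between graphs with equal decks; later the card is a clique or an
  independent set.\<close>

lemma deck_eq_iso_card:
  assumes V: "simple_graph V E" and W: "simple_graph W F" and deck: "deck k V E = deck k W F"
    and S: "S \<subseteq> V" "card S = k"
  obtains T where "T \<subseteq> W" "card T = k" "graph_iso S (induced E S) T (induced F T)"
proof -
  have fin: "finite (subsets_of_card k V)" "finite (subsets_of_card k W)"
    using V W by (simp_all add: simple_graph_def)
  have "iso_class S (induced E S) \<in># deck k V E" using S fin by (auto simp: deck_def)
  then have "iso_class S (induced E S) \<in># deck k W F" using deck by simp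
  then obtain T where T: "T \<subseteq> W" "card T = k" "iso_class S (induced E S) = iso_class T (induced F T)"
    using fin by (auto simp: deck_def)
  have "graph_iso S (induced E S) T (induced F T)"
    by (rule iso_class_eqD) (use T S simple_graph_induced[OF V] in auto)
  then show ?thesis using T that by blast
qed

section \<open>Double counting vertices of a given degree over all cards\<close>

lemma card_subsets_containing:
  assumes "finite V" "v \<in> V" "A \<subseteq> V - {v}" "t \<le> j"
  shows "card {S \<in> subsets_of_card (Suc j) V. v \<in> S \<and> card (A \<inter> S) = t}
       = (card A choose t) * ((card V - 1 - card A) choose (j - t))"
proof -
  let ?B = "V - {v} - A"
  have fin: "finite A" "finite ?B" using assms(1,3) by (auto intro: finite_subset)
  have B: "card ?B = card V - 1 - card A"
    using assms fin by (simp add: card_Diff_subset)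
  \<comment> \<open>Such an \<open>S\<close> consists of \<open>v\<close>, of \<open>t\<close>
    elements of \<open>A\<close>, and of \<open>j - t\<close> elements outside \<open>A\<close> and
    different from \<open>v\<close>. With \<open>A\<close> the neighbourhood of \<open>v\<close>,
    this counts the cards in which \<open>v\<close> has degree \<open>t\<close>.\<close>
  have "bij_betw (\<lambda>(P, Q). insert v (P \<union> Q)) (subsets_of_card t A \<times> subsets_of_card (j - t) ?B)
      {S \<in> subsets_of_card (Suc j) V. v \<in> S \<and> card (A \<inter> S) = t}"
  proof (rule bij_betw_byWitness[where f' = "\<lambda>S. (A \<inter> S, ?B \<inter> S)"])
    show "\<forall>a\<in>subsets_of_card t A \<times> subsets_of_card (j - t) ?B.
      (\<lambda>S. (A \<inter> S, ?B \<inter> S)) ((\<lambda>(P, Q). insert v (P \<union> Q)) a) = a"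
      using assms(3) by auto
    show "\<forall>S\<in>{S \<in> subsets_of_card (Suc j) V. v \<in> S \<and> card (A \<inter> S) = t}.
      (\<lambda>(P, Q). insert v (P \<union> Q)) (A \<inter> S, ?B \<inter> S) = S"
      using assms(3) by auto
    show "(\<lambda>(P, Q). insert v (P \<union> Q)) ` (subsets_of_card t A \<times> subsets_of_card (j - t) ?B)
      \<subseteq> {S \<in> subsets_of_card (Suc j) V. v \<in> S \<and> card (A \<inter> S) = t}"
    proof (rule image_subsetI)
      fix a assume "a \<in> subsets_of_card t A \<times> subsets_of_card (j - t) ?B"
      then obtain P Q where a: "a = (P, Q)" and P: "P \<subseteq> A" "card P = t" and Q: "Q \<subseteq> ?B" "card Q = j - t"
        by blast
      have "finite P" "finite Q" using P Q fin finite_subset by blast+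
      moreover have "P \<inter> Q = {}" "v \<notin> P \<union> Q" using P Q assms(3) by auto
      ultimately have "card (insert v (P \<union> Q)) = Suc j"
        using P Q assms(4) by (simp add: card_Un_disjoint)
      moreover have "A \<inter> insert v (P \<union> Q) = P" using P Q assms(3) by auto
      moreover have "insert v (P \<union> Q) \<subseteq> V" using P Q assms(2,3) by auto
      ultimately show "(\<lambda>(P, Q). insert v (P \<union> Q)) a
          \<in> {S \<in> subsets_of_card (Suc j) V. v \<in> S \<and> card (A \<inter> S) = t}"
        using P(2) by (simp add: a)
    qed
    show "(\<lambda>S. (A \<inter> S, ?B \<inter> S)) ` {S \<in> subsets_of_card (Suc j) V. v \<in> S \<and> card (A \<inter> S) = t}
      \<subseteq> subsets_of_card t A \<times> subsets_of_card (j - t) ?B"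
    proof (rule image_subsetI)
      fix S assume "S \<in> {S \<in> subsets_of_card (Suc j) V. v \<in> S \<and> card (A \<inter> S) = t}"
      then have S: "S \<subseteq> V" "card S = Suc j" "v \<in> S" "card (A \<inter> S) = t" by auto
      have fS: "finite S" using S(1) assms(1) finite_subset by blast
      have "S = insert v ((A \<inter> S) \<union> (?B \<inter> S))" using S assms(3) by auto
      moreover have "card (insert v ((A \<inter> S) \<union> (?B \<inter> S))) = Suc (card (A \<inter> S) + card (?B \<inter> S))"
        using assms(3) fS by (subst card_insert_disjoint) (auto intro!: card_Un_disjoint)
      ultimately have "Suc j = Suc (card (A \<inter> S) + card (?B \<inter> S))" using S by metis
      then show "(A \<inter> S, ?B \<inter> S) \<in> subsets_of_card t A \<times> subsets_of_card (j - t) ?B"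
        using S(4) by auto
    qed
  qed
  then have "card {S \<in> subsets_of_card (Suc j) V. v \<in> S \<and> card (A \<inter> S) = t}
      = card (subsets_of_card t A \<times> subsets_of_card (j - t) ?B)"
    by (simp add: bij_betw_same_card)
  then show ?thesis using fin B by (simp add: card_cartesian_product n_subsets)
qed

lemma count_degree_list:
  assumes "finite V"
  shows "count (degree_list V E) d = card {v \<in> V. degree E v = d}"
proof -
  have "count (degree_list V E) d = (\<Sum>v\<in>degree E -` {d} \<inter> V. count (mset_set V) v)"
    using assms by (simp add: degree_list_def count_image_mset)
  also have "\<dots> = card (degree E -` {d} \<inter> V)" using assms by simp
  also have "degree E -` {d} \<inter> V = {v \<in> V. degree E v = d}" by auto
  finally show ?thesis .
qed

lemma sum_degree_count:
  fixes g :: "nat \<Rightarrow> nat"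
  assumes "simple_graph V E" "card V = Suc N"
  shows "(\<Sum>v\<in>V. g (degree E v)) = (\<Sum>d\<le>N. count (degree_list V E) d * g d)"
proof -
  have fin: "finite V" using assms by (simp add: simple_graph_def)
  have "(\<Sum>v\<in>V. g (degree E v)) = (\<Sum>d\<le>N. \<Sum>v\<in>{v \<in> V. degree E v = d}. g (degree E v))"
    by (rule sum.group[symmetric]) (use fin degree_le[OF assms(1)] assms(2) in auto)
  also have "\<dots> = (\<Sum>d\<le>N. count (degree_list V E) d * g d)"
    using fin by (intro sum.cong) (auto simp: count_degree_list)
  finally show ?thesis .
qed

text \<open>Count the pairs of a card \<open>S\<close> and a vertex \<open>v\<close> of degree
  \<open>t\<close> in it. For fixed \<open>v\<close> the number of suitable \<open>S\<close> depends
  only on the degree of \<open>v\<close> in the whole graph.\<close>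

lemma sum_card_degrees:
  assumes G: "simple_graph V E" and n: "card V = Suc N" and t: "t \<le> j"
  shows "(\<Sum>S\<in>subsets_of_card (Suc j) V. count (degree_list S (induced E S)) t)
       = (\<Sum>d\<le>N. count (degree_list V E) d * ((d choose t) * ((N - d) choose (j - t))))"
proof -
  have fin: "finite V" using G by (simp add: simple_graph_def)
  then have finS: "finite (subsets_of_card (Suc j) V)" by simp
  have "(\<Sum>S\<in>subsets_of_card (Suc j) V. count (degree_list S (induced E S)) t)
      = (\<Sum>S\<in>subsets_of_card (Suc j) V. \<Sum>v\<in>V. of_bool (v \<in> S \<and> card (neighbours E v \<inter> S) = t))"
  proof (rule sum.cong[OF refl])
    fix S assume S: "S \<in> subsets_of_card (Suc j) V"
    then have "finite S" using fin finite_subset by auto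
    then have "count (degree_list S (induced E S)) t = card {v \<in> S. card (neighbours E v \<inter> S) = t}"
      using S degree_induced[OF G] by (auto simp: count_degree_list intro!: arg_cong[where f = card])
    also have "{v \<in> S. card (neighbours E v \<inter> S) = t} = V \<inter> {v. v \<in> S \<and> card (neighbours E v \<inter> S) = t}"
      using S by auto
    finally show "count (degree_list S (induced E S)) t
        = (\<Sum>v\<in>V. of_bool (v \<in> S \<and> card (neighbours E v \<inter> S) = t))"
      using fin by simp
  qed
  also have "\<dots> = (\<Sum>v\<in>V. \<Sum>S\<in>subsets_of_card (Suc j) V. of_bool (v \<in> S \<and> card (neighbours E v \<inter> S) = t))"
    by (rule sum.swap)
  also have "\<dots> = (\<Sum>v\<in>V. (degree E v choose t) * ((N - degree E v) choose (j - t)))"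
  proof (rule sum.cong[OF refl])
    fix v assume v: "v \<in> V"
    have "(\<Sum>S\<in>subsets_of_card (Suc j) V. of_bool (v \<in> S \<and> card (neighbours E v \<inter> S) = t))
        = card (subsets_of_card (Suc j) V \<inter> {S. v \<in> S \<and> card (neighbours E v \<inter> S) = t})"
      using finS by simp
    also have "subsets_of_card (Suc j) V \<inter> {S. v \<in> S \<and> card (neighbours E v \<inter> S) = t}
        = {S \<in> subsets_of_card (Suc j) V. v \<in> S \<and> card (neighbours E v \<inter> S) = t}" by auto
    also have "card \<dots> = (card (neighbours E v) choose t) * ((card V - 1 - card (neighbours E v)) choose (j - t))"
      by (rule card_subsets_containing[OF fin v neighbours_subset[OF G] t])
    finally show "(\<Sum>S\<in>subsets_of_card (Suc j) V. of_bool (v \<in> S \<and> card (neighbours E v \<inter> S) = t))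
        = (degree E v choose t) * ((N - degree E v) choose (j - t))"
      using n by (simp add: degree_eq_card_neighbours[OF G])
  qed
  also have "\<dots> = (\<Sum>d\<le>N. count (degree_list V E) d * ((d choose t) * ((N - d) choose (j - t))))"
    by (rule sum_degree_count[OF G n])
  finally show ?thesis .
qed

section \<open>Integer vectors orthogonal to polynomials of low degree\<close>

text \<open>Two applications of trinomial revision. After weighting by \<open>N choose d\<close>,
  the dependence on \<open>d\<close> is only through \<open>3 choose (d - t)\<close>, which is up to
  sign a third difference.\<close>

lemma binomial_triple_product:
  fixes N t d :: nat
  assumes "t + 3 \<le> N" "d \<le> N"
  shows "(N choose d) * ((d choose t) * ((N - d) choose (N - 3 - t)))
       = (N choose t) * ((N - t) choose 3) * (if t \<le> d then 3 choose (d - t) else 0)"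
proof (cases "t \<le> d")
  case False
  then show ?thesis by simp
next
  case True
  have 1: "(N choose d) * (d choose t) = (N choose t) * ((N - t) choose (d - t))"
    using choose_mult[OF True assms(2)] .
  \<comment> \<open>For \<open>d - t > 3\<close> both products vanish: the first because
    \<open>N - d < N - 3 - t\<close>, the second because of \<open>3 choose (d - t)\<close>.\<close>
  have 2: "((N - t) choose (d - t)) * ((N - d) choose (N - 3 - t)) = ((N - t) choose 3) * (3 choose (d - t))"
  proof (cases "d - t \<le> 3")
    case le: True
    have "(N - t) - (d - t) = N - d" using True assms by simp
    moreover have "(N - d) choose (N - 3 - t) = (N - d) choose (3 - (d - t))"
    proof -
      have "N - 3 - t \<le> N - d" "N - d - (N - 3 - t) = 3 - (d - t)" using assms True le by auto
      then show ?thesis using binomial_symmetric by metis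
    qed
    moreover have "((N - t) choose 3) * (3 choose (d - t)) = ((N - t) choose (d - t)) * ((N - t) - (d - t) choose (3 - (d - t)))"
      by (rule choose_mult) (use assms le in auto)
    ultimately show ?thesis by simp
  next
    case False
    then have "N - d < N - 3 - t" using assms by linarith
    then show ?thesis using False by (simp add: binomial_eq_0)
  qed
  show ?thesis
    unfolding mult.assoc[symmetric] 1 unfolding mult.assoc 2 using True by simp
qed

text \<open>The binomial products below span the polynomials of degree at most \<open>N - 3\<close>. This basis is
  chosen because the total number of vertices of degree \<open>t\<close> in all cards with \<open>N - 2\<close> vertices
  is a linear combination of the degree counts with exactly these coefficients.\<close>

definition annihilates :: "nat \<Rightarrow> (nat \<Rightarrow> int) \<Rightarrow> bool" where
  "annihilates N x \<longleftrightarrow>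
     (\<forall>t. t + 3 \<le> N \<longrightarrow> (\<Sum>d\<le>N. int ((d choose t) * ((N - d) choose (N - 3 - t))) * x d) = 0)"

text \<open>Dividing \<open>x d\<close> by the signed binomial
  \<open>(-1) ^ d * (N choose d)\<close> turns orthogonality to the basis vector with index
  \<open>t\<close> into the vanishing of the third difference of \<open>y\<close> at
  \<open>t\<close>, times the nonzero constant \<open>c\<close>.\<close>

lemma third_difference_zero:
  fixes x :: "nat \<Rightarrow> int"
  assumes ann: "annihilates N x" and t: "t + 3 \<le> N"
  defines "y \<equiv> \<lambda>d. (-1) ^ d * real_of_int (x d) / real (N choose d)"
  shows "y (t + 3) = 3 * y (t + 2) - 3 * y (t + 1) + y t"
proof -
  define c where "c = real (N choose t) * real ((N - t) choose 3)"
  have c0: "c \<noteq> 0" using t by (simp add: c_def)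
  have "0 = (\<Sum>d\<le>N. real ((d choose t) * ((N - d) choose (N - 3 - t))) * real_of_int (x d))"
  proof -
    have "(\<Sum>d\<le>N. int ((d choose t) * ((N - d) choose (N - 3 - t))) * x d) = 0"
      using ann t unfolding annihilates_def by blast
    then have "real_of_int (\<Sum>d\<le>N. int ((d choose t) * ((N - d) choose (N - 3 - t))) * x d) = 0"
      by simp
    then show ?thesis by simp
  qed
  also have "\<dots> = (\<Sum>d\<le>N. c * ((if t \<le> d then real (3 choose (d - t)) else 0) * ((-1) ^ d * y d)))"
  proof (rule sum.cong[OF refl])
    fix d assume "d \<in> {..N}"
    then have d: "d \<le> N" by simp
    have pos: "real (N choose d) \<noteq> 0" using d by simp
    have "real (N choose d) * real ((d choose t) * ((N - d) choose (N - 3 - t)))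
        = c * (if t \<le> d then real (3 choose (d - t)) else 0)"
      using arg_cong[OF binomial_triple_product[OF t d], of real] unfolding c_def by (simp split: if_splits)
    moreover have "real_of_int (x d) = (-1) ^ d * y d * real (N choose d)"
      using pos by (simp add: y_def field_simps flip: power_add mult_2)
    ultimately show "real ((d choose t) * ((N - d) choose (N - 3 - t))) * real_of_int (x d)
        = c * ((if t \<le> d then real (3 choose (d - t)) else 0) * ((-1) ^ d * y d))"
      by (simp add: algebra_simps)
  qed
  \<comment> \<open>Outside \<open>t, ..., t + 3\<close> the factor \<open>3 choose (d - t)\<close>
    or the conditional is zero.\<close>
  also have "\<dots> = (\<Sum>d\<in>{t, t+1, t+2, t+3}. c * ((if t \<le> d then real (3 choose (d - t)) else 0) * ((-1) ^ d * y d)))"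
    by (rule sum.mono_neutral_right) (use t in \<open>auto simp: binomial_eq_0\<close>)
  also have "\<dots> = c * (-1) ^ t * (y t - 3 * y (t + 1) + 3 * y (t + 2) - y (t + 3))"
    by (simp add: numeral_eq_Suc algebra_simps)
  finally show ?thesis using c0 by simp
qed

text \<open>The recurrence determines \<open>y\<close> from its first three values, and every
  quadratic satisfies it.\<close>

lemma quadratic_of_third_difference_zero:
  fixes y :: "nat \<Rightarrow> real"
  assumes "\<And>t. t + 3 \<le> N \<Longrightarrow> y (t + 3) = 3 * y (t + 2) - 3 * y (t + 1) + y t"
  shows "\<exists>a b c. \<forall>d\<le>N. y d = a + b * real d + c * (real d)\<^sup>2"
proof -
  \<comment> \<open>The coefficients of the quadratic through the values at 0, 1 and 2; its constant
    term is \<open>y 0\<close>.\<close>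
  define c where "c = (y 2 - 2 * y 1 + y 0) / 2"
  define b where "b = y 1 - y 0 - c"
  have "d \<le> N \<longrightarrow> y d = y 0 + b * real d + c * (real d)\<^sup>2" for d
  proof (induction d rule: less_induct)
    case (less d)
    consider "d = 0" | "d = 1" | "d = 2" | t where "d = t + 3"
      by (metis One_nat_def Suc_1 add_2_eq_Suc' add_Suc_right numeral_3_eq_3 old.nat.exhaust)
    then show ?case
    proof cases
      case (4 t)
      show ?thesis
      proof
        assume "d \<le> N"
        then have "y d = 3 * y (t + 2) - 3 * y (t + 1) + y t" using 4 assms by simp
        then show "y d = y 0 + b * real d + c * (real d)\<^sup>2"
          using less[of t] less[of "t+1"] less[of "t+2"] 4 \<open>d \<le> N\<close>
          by (simp add: algebra_simps power2_eq_square)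
      qed
    qed (auto simp: b_def c_def field_simps)
  qed
  then show ?thesis by blast
qed

section \<open>Vanishing of bounded integer solutions for \<open>N \<ge> 9\<close>\<close>

lemma binomial_lower_bounds:
  assumes "9 \<le> N"
  shows "35 * (2 * N + 1) < 8 * (N choose 3)"
    and "42 * (2 * N + 1) < 8 * (N choose 5)"
    and "15 * (2 * N + 1) < 8 * (N choose 7)"
proof -
  \<comment> \<open>The factors 35, 42, 15 and 8 are the weights of the interpolation used below.
    The case \<open>N = 9\<close> reads 665 < 672, 798 < 1008 and 285 < 288. Afterwards the left
    sides grow by 70, 84 and 30 per step, the right sides by at least 288, 1008 and 672.\<close>
  have s: "9 choose 2 = (36::nat)" "9 choose 3 = (84::nat)" "9 choose 4 = (126::nat)" "9 choose 5 = (126::nat)"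
     "9 choose 6 = (84::nat)" "9 choose 7 = (36::nat)"
    by code_simp+
  have mono: "9 choose k \<le> (m choose k)" if "9 \<le> m" for m k :: nat
    using that by (rule binomial_right_mono)
  have "35 * (2 * N + 1) < 8 * (N choose 3) \<and> 42 * (2 * N + 1) < 8 * (N choose 5) \<and> 15 * (2 * N + 1) < 8 * (N choose 7)"
    using assms
  proof (induction N rule: dec_induct)
    case base
    show ?case by (simp add: s)
  next
    case (step m)
    have "Suc m choose 3 = (m choose 2) + (m choose 3)" "Suc m choose 5 = (m choose 4) + (m choose 5)"
      "Suc m choose 7 = (m choose 6) + (m choose 7)"
      by (simp_all add: choose_reduce_nat)
    then show ?case using step mono[of m 2] mono[of m 4] mono[of m 6] s by simp
  qed
  then show "35 * (2 * N + 1) < 8 * (N choose 3)"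
    and "42 * (2 * N + 1) < 8 * (N choose 5)"
    and "15 * (2 * N + 1) < 8 * (N choose 7)" by auto
qed

text \<open>If \<open>x 0\<close> is a nonzero integer, the quadratic has absolute value at least 1
  at 0. By interpolation it cannot be small at 3, 5 and 7 at once, and the binomial factors there
  push the sum of absolute values beyond its bound.\<close>

lemma signed_binomial_quadratic_zero_at_0:
  fixes x :: "nat \<Rightarrow> int" and a b c :: real
  assumes N: "9 \<le> N"
    and x: "\<And>d. d \<le> N \<Longrightarrow> real_of_int (x d) = (-1) ^ d * real (N choose d) * (a + b * real d + c * (real d)\<^sup>2)"
    and sum: "(\<Sum>d\<le>N. \<bar>x d\<bar>) \<le> 2 * int N + 2"
  shows "x 0 = 0"
proof (rule ccontr)
  assume nz: "x 0 \<noteq> 0"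
  define p where "p d = a + b * real d + c * (real d)\<^sup>2" for d :: nat
  \<comment> \<open>What the bound \<open>2 * N + 2\<close> leaves for the other entries once
    \<open>x 0\<close> has used at least 1.\<close>
  define S where "S = real (2 * N + 1)"
  have p0: "real_of_int \<bar>x 0\<bar> = \<bar>p 0\<bar>" using x[of 0] by (simp add: p_def)
  have p: "real_of_int \<bar>x d\<bar> = real (N choose d) * \<bar>p d\<bar>" if "d \<le> N" for d
    using x[OF that] by (simp add: p_def abs_mult power_abs)
  \<comment> \<open>Lagrange interpolation at 0 from the nodes 3, 5, 7: a choice of three nodes that is good enough
     already for \<open>N = 9\<close>.\<close>
  have interp: "8 * p 0 = 35 * p 3 - 42 * p 5 + 15 * p 7"
    by (simp add: p_def power2_eq_square algebra_simps)
  have four: "\<bar>x 0\<bar> + \<bar>x 3\<bar> + \<bar>x 5\<bar> + \<bar>x 7\<bar> \<le> 2 * int N + 2"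
  proof -
    have "(\<Sum>d\<in>{0,3,5,7}. \<bar>x d\<bar>) \<le> (\<Sum>d\<le>N. \<bar>x d\<bar>)"
      by (rule sum_mono2) (use N in auto)
    then show ?thesis using sum by simp
  qed
  have x0: "1 \<le> \<bar>x 0\<bar>" using nz by simp
  then have three: "real_of_int \<bar>x 3\<bar> + real_of_int \<bar>x 5\<bar> + real_of_int \<bar>x 7\<bar> \<le> S"
    using four by (simp add: S_def)
  \<comment> \<open>The factor of \<open>\<bar>p d\<bar>\<close> is strictly smaller on the left, so
    equality is possible only when \<open>p d\<close> vanishes.\<close>
  have bnd: "k * S * \<bar>p d\<bar> \<le> 8 * real_of_int \<bar>x d\<bar>" "k * S * \<bar>p d\<bar> = 8 * real_of_int \<bar>x d\<bar> \<Longrightarrow> x d = 0"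
    if "d \<le> N" "k * S < 8 * real (N choose d)" for d k
  proof -
    have "8 * real_of_int \<bar>x d\<bar> = 8 * real (N choose d) * \<bar>p d\<bar>" using p[OF that(1)] by simp
    then show "k * S * \<bar>p d\<bar> \<le> 8 * real_of_int \<bar>x d\<bar>"
      using mult_right_mono[of "k * S" "8 * real (N choose d)" "\<bar>p d\<bar>"] that by simp
    assume "k * S * \<bar>p d\<bar> = 8 * real_of_int \<bar>x d\<bar>"
    then have "p d = 0" using \<open>8 * real_of_int \<bar>x d\<bar> = 8 * real (N choose d) * \<bar>p d\<bar>\<close> that by auto
    then show "x d = 0" using p[OF that(1)] by simp
  qed
  have Sp: "S > 0" by (simp add: S_def)
  have c3: "35 * S < 8 * real (N choose 3)" and c5: "42 * S < 8 * real (N choose 5)" and c7: "15 * S < 8 * real (N choose 7)"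
    using binomial_lower_bounds[OF N] unfolding S_def by linarith+
  have le: "3 \<le> N" "5 \<le> N" "7 \<le> N" using N by auto
  have "8 * S \<le> S * (8 * \<bar>p 0\<bar>)" using x0 p0 Sp by simp
  also have "\<dots> \<le> S * (35 * \<bar>p 3\<bar> + 42 * \<bar>p 5\<bar> + 15 * \<bar>p 7\<bar>)"
    by (rule mult_left_mono) (use interp Sp in auto)
  also have "\<dots> = 35 * S * \<bar>p 3\<bar> + 42 * S * \<bar>p 5\<bar> + 15 * S * \<bar>p 7\<bar>" by (simp add: algebra_simps)
  finally have ge: "8 * S \<le> 35 * S * \<bar>p 3\<bar> + 42 * S * \<bar>p 5\<bar> + 15 * S * \<bar>p 7\<bar>" .
  note b = bnd(1)[OF le(1) c3] bnd(1)[OF le(2) c5] bnd(1)[OF le(3) c7]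
  \<comment> \<open>The lower bound \<open>8 * S\<close> for the left-hand sides and the upper bound
    \<open>8 * S\<close> for the right-hand sides meet, so all three inequalities are
    equalities.\<close>
  have "35 * S * \<bar>p 3\<bar> = 8 * real_of_int \<bar>x 3\<bar>" "42 * S * \<bar>p 5\<bar> = 8 * real_of_int \<bar>x 5\<bar>"
    "15 * S * \<bar>p 7\<bar> = 8 * real_of_int \<bar>x 7\<bar>"
    using b ge three by linarith+
  then have "x 3 = 0" "x 5 = 0" "x 7 = 0" using bnd(2) le c3 c5 c7 by blast+
  then show False using b ge Sp by simp
qed

text \<open>The quadratic vanishes at 0 and, by reflection, at \<open>N\<close>, so it is
  \<open>c * d * (d - N)\<close>. Then \<open>x 1\<close> determines \<open>x 3\<close>, which would
  be too large if \<open>x 1\<close> were nonzero.\<close>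

lemma annihilates_zero_large:
  fixes x :: "nat \<Rightarrow> int"
  assumes N: "9 \<le> N" and ann: "annihilates N x"
    and sum: "(\<Sum>d\<le>N. \<bar>x d\<bar>) \<le> 2 * int N + 2"
    and d: "d \<le> N"
  shows "x d = 0"
proof -
  obtain a b c where y: "\<And>d. d \<le> N \<Longrightarrow> (-1) ^ d * real_of_int (x d) / real (N choose d) = a + b * real d + c * (real d)\<^sup>2"
    using quadratic_of_third_difference_zero[of N "\<lambda>d. (-1) ^ d * real_of_int (x d) / real (N choose d)"]
      third_difference_zero[OF ann] by blast
  have x: "real_of_int (x d) = (-1) ^ d * real (N choose d) * (a + b * real d + c * (real d)\<^sup>2)" if "d \<le> N" for d
  proof -
    have "real_of_int (x d) = (-1) ^ d * real (N choose d) * ((-1) ^ d * real_of_int (x d) / real (N choose d))"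
      using that by simp
    then show ?thesis unfolding y[OF that] .
  qed
  have x0: "x 0 = 0" using signed_binomial_quadratic_zero_at_0[OF N x sum] .
  \<comment> \<open>The reflection \<open>d \<mapsto> N - d\<close> preserves the binomials, changes
    the signs by the constant \<open>(-1) ^ N\<close>, and turns the quadratic into another one. The
    form \<open>N - 0\<close> matches the entry at 0 of the reflected vector.\<close>
  have "x (N - 0) = 0"
  proof (rule signed_binomial_quadratic_zero_at_0[OF N, where x = "\<lambda>d. x (N - d)"])
    fix d assume d: "d \<le> N"
    have sgn: "(-1::real) ^ (N - d) = (-1) ^ d * (-1) ^ N"
    proof -
      obtain m where "N = m + d" using d by (metis le_add_diff_inverse2)
      then show ?thesis by (simp add: power_add mult.left_commute)
    qed
    show "real_of_int (x (N - d)) = (-1) ^ d * real (N choose d) *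
       ((-1) ^ N * (a + b * real N + c * (real N)\<^sup>2) + (-1) ^ N * (- b - 2 * c * real N) * real d + ((-1) ^ N * c) * (real d)\<^sup>2)"
      using x[of "N - d"] d sgn binomial_symmetric[OF d]
      by (simp add: algebra_simps power2_eq_square)
  next
    have "(\<Sum>d\<le>N. \<bar>x (N - d)\<bar>) = (\<Sum>d\<le>N. \<bar>x d\<bar>)"
      by (rule sum.reindex_bij_witness[of _ "\<lambda>d. N - d" "\<lambda>d. N - d"]) auto
    then show "(\<Sum>d\<le>N. \<bar>x (N - d)\<bar>) \<le> 2 * int N + 2" using sum by simp
  qed
  then have xN: "x N = 0" by simp
  have a0: "a = 0" using x[of 0] x0 by simp
  have "b * real N + c * (real N)\<^sup>2 = 0" using x[of N] xN a0 by simp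
  then have "real N * (b + c * real N) = 0" by (simp add: algebra_simps power2_eq_square)
  then have b: "b = - c * real N" using N by simp
  have x1: "real_of_int (x 1) = c * (real N * (real N - 1))" using x[of 1] N a0 b by (simp add: algebra_simps)
  have C3: "real (N choose 3) = real N * (real N - 1) * (real N - 2) / 6"
    using N by (simp add: binomial_gbinomial gbinomial_prod_rev numeral_eq_Suc)
  have "real_of_int (x 3) = real (N choose 3) * (3 * c * (real N - 3))"
    using x[of 3] N a0 b by (simp add: algebra_simps power2_eq_square)
  then have "2 * real_of_int (x 3) = real_of_int (x 1) * ((real N - 2) * (real N - 3))"
    unfolding x1 C3 by (simp add: algebra_simps)
  moreover have "real_of_int ((int N - 2) * (int N - 3)) = (real N - 2) * (real N - 3)" by simp
  ultimately have "real_of_int (2 * x 3) = real_of_int (x 1 * ((int N - 2) * (int N - 3)))" by simp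
  then have x3: "2 * x 3 = x 1 * ((int N - 2) * (int N - 3))" by linarith
  \<comment> \<open>Otherwise \<open>2 * \<bar>x 3\<bar>\<close> is at least
    \<open>7 * (N - 3)\<close>. Twice the bound on \<open>\<bar>x 1\<bar> + \<bar>x 3\<bar>\<close>
    then gives \<open>2 + 7 * (N - 3) \<le> 4 * N + 4\<close>, which fails for
    \<open>N \<ge> 9\<close>.\<close>
  have "x 1 = 0"
  proof (rule ccontr)
    assume "x 1 \<noteq> 0"
    then have "1 \<le> \<bar>x 1\<bar>" by simp
    have q: "7 * (int N - 3) \<le> (int N - 2) * (int N - 3)" by (rule mult_right_mono) (use N in auto)
    have "(int N - 2) * (int N - 3) \<le> \<bar>x 1\<bar> * ((int N - 2) * (int N - 3))"
      using mult_right_mono[OF \<open>1 \<le> \<bar>x 1\<bar>\<close>, of "(int N - 2) * (int N - 3)"] N by simp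
    also have "\<dots> = 2 * \<bar>x 3\<bar>" using arg_cong[OF x3, of abs] N by (simp add: abs_mult)
    finally have "7 * (int N - 3) \<le> 2 * \<bar>x 3\<bar>" using q by simp
    moreover have "(\<Sum>d\<in>{1,3}. \<bar>x d\<bar>) \<le> (\<Sum>d\<le>N. \<bar>x d\<bar>)" by (rule sum_mono2) (use N in auto)
    ultimately show False using sum \<open>1 \<le> \<bar>x 1\<bar>\<close> N by simp
  qed
  then have "c = 0" using x1 N by simp
  then show ?thesis using x[OF d] a0 b by simp
qed

text \<open>The triangle inequality, with the weights in a list so that sign vectors can be written
  out literally. Weight 0 is allowed and drops an entry.\<close>

lemma signed_sum_le:
  fixes x :: "nat \<Rightarrow> int"
  assumes "(\<Sum>d\<le>N. \<bar>x d\<bar>) \<le> B" "\<forall>s\<in>set e. \<bar>s\<bar> \<le> 1" "length e = Suc N"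
  shows "\<bar>\<Sum>d\<le>N. e ! d * x d\<bar> \<le> B"
proof -
  have "\<bar>\<Sum>d\<le>N. e ! d * x d\<bar> \<le> (\<Sum>d\<le>N. \<bar>e ! d * x d\<bar>)" by (rule sum_abs)
  also have "\<dots> \<le> (\<Sum>d\<le>N. \<bar>x d\<bar>)"
  proof (rule sum_mono)
    fix d assume "d \<in> {..N}"
    then have "e ! d \<in> set e" using assms(3) by simp
    then have "\<bar>e ! d\<bar> \<le> 1" using assms(2) by blast
    then show "\<bar>e ! d * x d\<bar> \<le> \<bar>x d\<bar>" by (simp add: abs_mult mult_left_le_one_le)
  qed
  finally show ?thesis using assms(1) by simp
qed

text \<open>For \<open>N = 6, 7, 8\<close> the integer solutions form a lattice with coordinates \<open>k, l, m\<close>. The sign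
  vectors are chosen so that the signed sum is a large multiple of a primitive linear form in
  \<open>k, l, m\<close>; the bound on the sum of absolute values then confines that form to very few values.\<close>

lemma abs_less_of_multiple_le:
  fixes c t b n :: int
  assumes "\<bar>c * t\<bar> \<le> b" "b < c * n" "0 < c"
  shows "\<bar>t\<bar> < n"
proof -
  have "c * \<bar>t\<bar> = \<bar>c * t\<bar>" using assms(3) by (simp add: abs_mult)
  also have "\<dots> < c * n" using assms(1,2) by (rule le_less_trans)
  finally show ?thesis using assms(3) by (rule mult_less_cancel_left_pos[THEN iffD1, rotated])
qed

section \<open>The orthogonality relations written out and solved for
  \<open>N = 6, 7, 8\<close>\<close>

lemma annihilates_6:
  assumes "annihilates 6 x"
  shows "20 * x 0 + 10 * x 1 + 4 * x 2 + x 3 = 0"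
    and "10 * x 1 + 12 * x 2 + 9 * x 3 + 4 * x 4 = 0"
    and "4 * x 2 + 9 * x 3 + 12 * x 4 + 10 * x 5 = 0"
    and "x 3 + 4 * x 4 + 10 * x 5 + 20 * x 6 = 0"
  using assms[unfolded annihilates_def, rule_format, of 0]
    assms[unfolded annihilates_def, rule_format, of 1]
    assms[unfolded annihilates_def, rule_format, of 2]
    assms[unfolded annihilates_def, rule_format, of 3]
  by (simp_all add: atMost_nat_numeral choose_reduce_nat[of "numeral _"] binomial_eq_0)

text \<open>Common factors are cancelled: 4 for \<open>t = 1\<close> and \<open>t = 3\<close>, and 2
  for \<open>t = 2\<close>.\<close>

lemma annihilates_7:
  assumes "annihilates 7 x"
  shows "35 * x 0 + 15 * x 1 + 5 * x 2 + x 3 = 0"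
    and "5 * x 1 + 5 * x 2 + 3 * x 3 + x 4 = 0"
    and "5 * x 2 + 9 * x 3 + 9 * x 4 + 5 * x 5 = 0"
    and "x 3 + 3 * x 4 + 5 * x 5 + 5 * x 6 = 0"
    and "x 4 + 5 * x 5 + 15 * x 6 + 35 * x 7 = 0"
  using assms[unfolded annihilates_def, rule_format, of 0]
    assms[unfolded annihilates_def, rule_format, of 1]
    assms[unfolded annihilates_def, rule_format, of 2]
    assms[unfolded annihilates_def, rule_format, of 3]
    assms[unfolded annihilates_def, rule_format, of 4]
  by (simp_all add: atMost_nat_numeral choose_reduce_nat[of "numeral _"] binomial_eq_0)

lemma annihilates_8:
  assumes "annihilates 8 x"
  shows "56 * x 0 + 21 * x 1 + 6 * x 2 + x 3 = 0"
    and "35 * x 1 + 30 * x 2 + 15 * x 3 + 4 * x 4 = 0"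
    and "10 * x 2 + 15 * x 3 + 12 * x 4 + 5 * x 5 = 0"
    and "5 * x 3 + 12 * x 4 + 15 * x 5 + 10 * x 6 = 0"
    and "4 * x 4 + 15 * x 5 + 30 * x 6 + 35 * x 7 = 0"
    and "x 5 + 6 * x 6 + 21 * x 7 + 56 * x 8 = 0"
  using assms[unfolded annihilates_def, rule_format, of 0]
    assms[unfolded annihilates_def, rule_format, of 1]
    assms[unfolded annihilates_def, rule_format, of 2]
    assms[unfolded annihilates_def, rule_format, of 3]
    assms[unfolded annihilates_def, rule_format, of 4]
    assms[unfolded annihilates_def, rule_format, of 5]
  by (simp_all add: atMost_nat_numeral choose_reduce_nat[of "numeral _"] binomial_eq_0)

text \<open>Four equations in seven unknowns leave a lattice of rank three. The bound admits zero
  and three pairs of opposite vectors.\<close>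

lemma annihilates_bounded_6:
  assumes ann: "annihilates 6 x" and b: "(\<Sum>d\<le>6. \<bar>x d\<bar>) \<le> 14"
  shows "[x 0, x 1, x 2, x 3, x 4, x 5, x 6] \<in>
    {[0, 0, 0, 0, 0, 0, 0],
     [0, 1, -3, 2, 2, -3, 1], [0, -1, 3, -2, -2, 3, -1],
     [1, -3, 2, 2, -3, 1, 0], [-1, 3, -2, -2, 3, -1, 0],
     [1, -2, -1, 4, -1, -2, 1], [-1, 2, 1, -4, 1, 2, -1]}"
proof -
  note r = annihilates_6[OF ann]
  \<comment> \<open>These congruences make the coordinates \<open>k\<close>, \<open>l\<close>,
    \<open>m\<close> integers.\<close>
  have "2 dvd x 3" using r(1) by presburger
  moreover have "5 dvd x 2 - x 3" using r(1) by presburger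
  moreover have "5 dvd x 4 - x 3" using r(4) by presburger
  ultimately obtain k l m where "x 3 = 2 * k" "x 2 - x 3 = 5 * l" "x 4 - x 3 = 5 * m" by (elim dvdE)
  then have x: "x 0 = 2 * k + 2 * l + m" "x 1 = - 5 * k - 6 * l - 2 * m" "x 2 = 2 * k + 5 * l" "x 3 = 2 * k"
    "x 4 = 2 * k + 5 * m" "x 5 = - 5 * k - 2 * l - 6 * m" "x 6 = 2 * k + l + 2 * m"
    using r by auto
  note s = signed_sum_le[OF b]
  have "\<bar>16 * (k + l + m)\<bar> \<le> 14"
    using s[of "[1, -1, 1, -1, 1, -1, 1]"] x by (simp add: atMost_nat_numeral algebra_simps)
  then have m1: "\<bar>k + l + m\<bar> < 1"
    by (rule abs_less_of_multiple_le) simp_all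
  have "\<bar>10 * (l - m)\<bar> \<le> 14"
    using s[of "[1, -1, 1, 0, -1, 1, -1]"] x by (simp add: atMost_nat_numeral algebra_simps)
  then have m2: "\<bar>l - m\<bar> < 2"
    by (rule abs_less_of_multiple_le) simp_all
  have "\<bar>9 * (k + m)\<bar> \<le> 14"
    using s[of "[1, 0, -1, 1, 0, -1, 1]"] x by (simp add: atMost_nat_numeral algebra_simps)
  then have m3: "\<bar>k + m\<bar> < 2"
    by (rule abs_less_of_multiple_le) simp_all
  have "\<bar>9 * (k + l)\<bar> \<le> 14"
    using s[of "[1, -1, 0, 1, -1, 0, 1]"] x by (simp add: atMost_nat_numeral algebra_simps)
  then have m4: "\<bar>k + l\<bar> < 2"
    by (rule abs_less_of_multiple_le) simp_all
  have k: "k = - l - m" using m1 by linarith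
  \<comment> \<open>With \<open>k = - l - m\<close> the forms in \<open>m3\<close> and
    \<open>m4\<close> are \<open>- l\<close> and \<open>- m\<close>. Of the nine remaining pairs,
    \<open>m2\<close> removes the two with \<open>l = - m\<close> nonzero.\<close>
  have "l = -1 \<or> l = 0 \<or> l = 1" using m3 k by linarith
  moreover have "m = -1 \<or> m = 0 \<or> m = 1" using m4 k by linarith
  ultimately have "(k, l, m) \<in> {(0, 0, 0), (1, -1, 0), (-1, 1, 0), (1, 0, -1), (-1, 0, 1), (2, -1, -1), (-2, 1, 1)}"
    using m2 k by (elim disjE) simp_all
  then show ?thesis
    unfolding x insert_iff empty_iff prod.inject by (elim disjE conjE FalseE; hypsubst; simp)
qed

text \<open>The multipliers 32, 20 and 18 all exceed the bound 16, so three linearly independent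
  forms vanish.\<close>

lemma annihilates_bounded_7:
  assumes ann: "annihilates 7 x" and b: "(\<Sum>d\<le>7. \<bar>x d\<bar>) \<le> 16" and d: "d \<le> 7"
  shows "x d = 0"
proof -
  note r = annihilates_7[OF ann]
  have "5 dvd x 3" using r(1) by presburger
  moreover have "5 dvd x 4" using r(5) by presburger
  ultimately obtain k l where kl: "x 3 = 5 * k" "x 4 = 5 * l" by (elim dvdE)
  \<comment> \<open>Eliminating \<open>x 1\<close> from the first two relations gives
    \<open>7 * x 0 = 2 * x 2 + 8 * k + 3 * l\<close>. Four times this yields the divisibility by
    7.\<close>
  have "x 2 - 3 * k - 2 * l = 7 * (4 * x 0 - 5 * k - 2 * l - x 2)" using r kl by simp
  then obtain m where "x 2 - 3 * k - 2 * l = 7 * m" by blast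
  then have x: "x 0 = 2 * k + l + 2 * m" "x 1 = - 6 * k - 3 * l - 7 * m" "x 2 = 3 * k + 2 * l + 7 * m"
    "x 3 = 5 * k" "x 4 = 5 * l" "x 5 = - 12 * k - 11 * l - 7 * m" "x 6 = 11 * k + 8 * l + 7 * m"
    "x 7 = - 3 * k - 2 * l - 2 * m"
    using r kl by auto
  note s = signed_sum_le[OF b]
  have "\<bar>32 * (k + l + m)\<bar> \<le> 16"
    using s[of "[1, -1, 1, -1, 1, -1, 1, -1]"] x by (simp add: atMost_nat_numeral algebra_simps)
  then have m1: "\<bar>k + l + m\<bar> < 1"
    by (rule abs_less_of_multiple_le) simp_all
  have "\<bar>20 * (k + l)\<bar> \<le> 16"
    using s[of "[-1, 1, -1, 1, 1, -1, 1, -1]"] x by (simp add: atMost_nat_numeral algebra_simps)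
  then have m2: "\<bar>k + l\<bar> < 1"
    by (rule abs_less_of_multiple_le) simp_all
  have "\<bar>18 * (k + m)\<bar> \<le> 16"
    using s[of "[1, -1, 1, 1, -1, 1, 1, -1]"] x by (simp add: atMost_nat_numeral algebra_simps)
  then have m3: "\<bar>k + m\<bar> < 1"
    by (rule abs_less_of_multiple_le) simp_all
  have "k = 0" "l = 0" "m = 0" using m1 m2 m3 by auto
  moreover have "d \<in> {0, 1, 2, 3, 4, 5, 6, 7}" using d by auto
  ultimately show ?thesis using x by auto
qed

text \<open>The multipliers 64, 35 and 27 all exceed the bound 18, and the three forms have only the
  trivial common zero.\<close>

lemma annihilates_bounded_8:
  assumes ann: "annihilates 8 x" and b: "(\<Sum>d\<le>8. \<bar>x d\<bar>) \<le> 18" and d: "d \<le> 8"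
  shows "x d = 0"
proof -
  note r = annihilates_8[OF ann]
  have "5 dvd x 4" using r(2) by presburger
  then obtain k where k: "x 4 = 5 * k" by (elim dvdE)
  have x1: "7 * x 1 = - 6 * x 2 - 3 * x 3 - 4 * k" and x0: "14 * x 0 = 3 * x 2 + 2 * x 3 + 3 * k"
    using r k by auto
  \<comment> \<open>The bracketed integers witness that \<open>x 2\<close> and \<open>x 3\<close>
    are congruent to \<open>5 * k\<close> modulo 14 and 7; both identities follow from
    \<open>x0\<close> and \<open>x1\<close>.\<close>
  have "x 2 - 5 * k = 14 * (- x 2 - 5 * (3 * x 0 + x 1))"
    and "x 3 - 5 * k = 7 * (8 * x 0 - 9 * x 2 - 34 * (3 * x 0 + x 1) - x 3)"
    using x0 x1 by auto
  then obtain l m where "x 2 - 5 * k = 14 * m" "x 3 - 5 * k = 7 * l" by blast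
  then have x: "x 0 = 2 * k + l + 3 * m" "x 1 = - 7 * k - 3 * l - 12 * m" "x 2 = 5 * k + 14 * m"
    "x 3 = 5 * k + 7 * l" "x 4 = 5 * k" "x 5 = - 37 * k - 21 * l - 28 * m" "x 6 = 47 * k + 28 * l + 42 * m"
    "x 7 = - 25 * k - 15 * l - 24 * m" "x 8 = 5 * k + 3 * l + 5 * m"
    using r k by auto
  note s = signed_sum_le[OF b]
  have "\<bar>64 * (2 * k + l + 2 * m)\<bar> \<le> 18"
    using s[of "[1, -1, 1, -1, 1, -1, 1, -1, 1]"] x by (simp add: atMost_nat_numeral algebra_simps)
  then have m1: "\<bar>2 * k + l + 2 * m\<bar> < 1"
    by (rule abs_less_of_multiple_le) simp_all
  have "\<bar>35 * (3 * k + 2 * l + 2 * m)\<bar> \<le> 18"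
    using s[of "[-1, 1, -1, 1, 0, -1, 1, -1, 1]"] x by (simp add: atMost_nat_numeral algebra_simps)
  then have m2: "\<bar>3 * k + 2 * l + 2 * m\<bar> < 1"
    by (rule abs_less_of_multiple_le) simp_all
  have "\<bar>27 * m\<bar> \<le> 18"
    using s[of "[0, -1, 1, 0, -1, 1, 0, -1, 1]"] x by (simp add: atMost_nat_numeral algebra_simps)
  then have m3: "\<bar>m\<bar> < 1"
    by (rule abs_less_of_multiple_le) simp_all
  have "k = 0" "l = 0" "m = 0" using m1 m2 m3 by auto
  moreover have "d \<in> {0, 1, 2, 3, 4, 5, 6, 7, 8}" using d by auto
  ultimately show ?thesis using x by auto
qed

section \<open>Degree counts of graphs with a common deck\<close>

text \<open>The number of vertices of degree \<open>t\<close> over all cards is determined by the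
  deck. In both graphs it is the same linear combination of degree counts, and subtracting gives the
  relation for \<open>t\<close>.\<close>

lemma deck_eq_annihilates:
  assumes G: "simple_graph V E" "card V = Suc N" and H: "simple_graph W F" "card W = Suc N"
    and deck: "deck (N - 2) V E = deck (N - 2) W F"
  shows "annihilates N (\<lambda>d. int (count (degree_list V E) d) - int (count (degree_list W F) d))"
  unfolding annihilates_def
proof (intro allI impI)
  fix t assume t: "t + 3 \<le> N"
  \<comment> \<open>The counting lemma speaks of cards with \<open>Suc j\<close> vertices, so here
    \<open>j = N - 3\<close>.\<close>
  then have N2: "N - 2 = Suc (N - 3)" by simp
  have cards: "(\<Sum>S\<in>subsets_of_card (N - 2) V. count (degree_list S (induced E S)) t)
      = (\<Sum>S\<in>subsets_of_card (N - 2) W. count (degree_list S (induced F S)) t)"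
    using arg_cong[OF deck, of "\<lambda>D. \<Sum>L\<in>#image_mset (\<lambda>c. degree_list {0..<N - 2} (SOME X. X \<in> c)) D. count L t"]
    by (simp add: sum_unfold_sum_mset image_mset.compositionality comp_def
        flip: deck_degree_lists[OF G(1)] deck_degree_lists[OF H(1)])
  have "(\<Sum>d\<le>N. count (degree_list V E) d * ((d choose t) * ((N - d) choose (N - 3 - t))))
      = (\<Sum>d\<le>N. count (degree_list W F) d * ((d choose t) * ((N - d) choose (N - 3 - t))))"
    using cards sum_card_degrees[OF G, of t "N - 3"] sum_card_degrees[OF H, of t "N - 3"] t
    unfolding N2 by simp
  then have "(\<Sum>d\<le>N. int (count (degree_list V E) d * ((d choose t) * ((N - d) choose (N - 3 - t)))))
      = (\<Sum>d\<le>N. int (count (degree_list W F) d * ((d choose t) * ((N - d) choose (N - 3 - t)))))"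
    by (simp only: flip: of_nat_sum)
  then show "(\<Sum>d\<le>N. int ((d choose t) * ((N - d) choose (N - 3 - t))) *
      (int (count (degree_list V E) d) - int (count (degree_list W F) d))) = 0"
    by (simp add: algebra_simps sum_subtractf)
qed

lemma sum_abs_count_diff_le:
  assumes G: "simple_graph V E" "card V = Suc N" and H: "simple_graph W F" "card W = Suc N"
  shows "(\<Sum>d\<le>N. \<bar>int (count (degree_list V E) d) - int (count (degree_list W F) d)\<bar>) \<le> 2 * int N + 2"
proof -
  have "(\<Sum>d\<le>N. \<bar>int (count (degree_list V E) d) - int (count (degree_list W F) d)\<bar>)
      \<le> (\<Sum>d\<le>N. int (count (degree_list V E) d) + int (count (degree_list W F) d))"
    by (rule sum_mono) simp
  also have "\<dots> = int (\<Sum>d\<le>N. count (degree_list V E) d * 1) + int (\<Sum>d\<le>N. count (degree_list W F) d * 1)"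
    by (simp add: sum.distrib)
  also have "\<dots> = int (card V) + int (card W)"
    unfolding sum_degree_count[OF G, of "\<lambda>_. 1", symmetric] sum_degree_count[OF H, of "\<lambda>_. 1", symmetric]
    by simp
  finally show ?thesis using G(2) H(2) by simp
qed

lemma degree_list_eqI:
  assumes G: "simple_graph V E" "card V = Suc N" and H: "simple_graph W F" "card W = Suc N"
    and eq: "\<And>d. d \<le> N \<Longrightarrow> int (count (degree_list V E) d) - int (count (degree_list W F) d) = 0"
  shows "degree_list V E = degree_list W F"
proof (rule multiset_eqI)
  fix d
  show "count (degree_list V E) d = count (degree_list W F) d"
  proof (cases "d \<le> N")
    case True
    then show ?thesis using eq by simp
  next
    case False
    have "{v \<in> V. degree E v = d} = {}" "{v \<in> W. degree F v = d} = {}"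
      using degree_le[OF G(1)] degree_le[OF H(1)] G(2) H(2) False by force+
    then have "card {v \<in> V. degree E v = d} = 0" "card {v \<in> W. degree F v = d} = 0"
      by (simp_all only: card.empty)
    moreover have "finite V" "finite W" using G(1) H(1) by (simp_all add: simple_graph_def)
    ultimately show ?thesis by (simp only: count_degree_list)
  qed
qed

text \<open>A vertex of degree \<open>N\<close> is adjacent to all others, hence to the isolated
  one; \<open>0 < N\<close> makes the two distinct.\<close>

lemma degree_zero_dominating_incompatible:
  assumes G: "simple_graph V E" "card V = Suc N" and "0 < N"
    and "count (degree_list V E) 0 > 0" "count (degree_list V E) N > 0"
  shows False
proof -
  have fin: "finite V" using G by (simp add: simple_graph_def)
  obtain u v where u: "u \<in> V" "degree E u = 0" and v: "v \<in> V" "degree E v = N"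
    using assms(4,5) fin by (auto simp: count_degree_list card_gt_0_iff)
  have "neighbours E u = {}"
    using u degree_eq_card_neighbours[OF G(1)] finite_neighbours[OF G(1)] by simp
  moreover have "neighbours E v = V - {v}"
    using v neighbours_subset[OF G(1)] degree_eq_card_neighbours[OF G(1)] fin G(2)
    by (intro card_subset_eq) auto
  ultimately have "u \<notin> V - {v}" using neighbours_sym by fastforce
  then show False using u v assms(3) by auto
qed

lemma large_degree_list:
  assumes n: "8 \<le> n" and G: "simple_graph V E" "card V = n" and H: "simple_graph W F" "card W = n"
    and deck: "deck (n - 3) V E = deck (n - 3) W F"
  shows "degree_list V E = degree_list W F"
proof -
  obtain N where N: "n = Suc N" "7 \<le> N" using n by (cases n) auto
  have G': "card V = Suc N" and H': "card W = Suc N" using G H N by simp_all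
  define x where "x d = int (count (degree_list V E) d) - int (count (degree_list W F) d)" for d
  have ann: "annihilates N x"
    using deck_eq_annihilates[OF G(1) G' H(1) H'] deck N by (simp add: x_def[abs_def])
  have sum: "(\<Sum>d\<le>N. \<bar>x d\<bar>) \<le> 2 * int N + 2"
    using sum_abs_count_diff_le[OF G(1) G' H(1) H'] by (simp add: x_def)
  have "x d = 0" if "d \<le> N" for d
  proof -
    consider "N = 7" | "N = 8" | "9 \<le> N" using N(2) by linarith
    then show ?thesis
    proof cases
      case 1
      then show ?thesis using annihilates_bounded_7[of x d] ann sum that by simp
    next
      case 2
      then show ?thesis using annihilates_bounded_8[of x d] ann sum that by simp
    next
      case 3
      then show ?thesis using annihilates_zero_large ann sum that by blast
    qed
  qed
  then show ?thesis by (intro degree_list_eqI[OF G(1) G' H(1) H']) (simp add: x_def)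
qed

section \<open>Seven vertices\<close>

text \<open>Both sides count the adjacent pairs in \<open>A \<times> B\<close>.\<close>

lemma sum_card_neighbours_swap:
  assumes "finite A" "finite B"
  shows "(\<Sum>u\<in>A. card (neighbours E u \<inter> B)) = (\<Sum>v\<in>B. card (neighbours E v \<inter> A))"
proof -
  have "(\<Sum>u\<in>A. card (neighbours E u \<inter> B)) = (\<Sum>u\<in>A. \<Sum>v\<in>B. of_bool (v \<in> neighbours E u))"
    using assms by (simp add: Int_commute)
  also have "\<dots> = (\<Sum>v\<in>B. \<Sum>u\<in>A. of_bool (u \<in> neighbours E v))"
    by (subst sum.swap) (simp add: neighbours_sym)
  also have "\<dots> = (\<Sum>v\<in>B. card (neighbours E v \<inter> A))"
    using assms by (simp add: Int_commute)
  finally show ?thesis .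
qed

section \<open>A 4-clique and an independent 4-set sharing one vertex\<close>

definition clique :: "'a set set \<Rightarrow> 'a set \<Rightarrow> bool" where
  "clique E K \<longleftrightarrow> (\<forall>u\<in>K. \<forall>v\<in>K. u \<noteq> v \<longrightarrow> {u, v} \<in> E)"

text \<open>The diagonal may be included, as a singleton is never an edge of a simple graph.\<close>

definition independent :: "'a set set \<Rightarrow> 'a set \<Rightarrow> bool" where
  "independent E I \<longleftrightarrow> (\<forall>u\<in>I. \<forall>v\<in>I. {u, v} \<notin> E)"

lemma clique_transfer:
  assumes "graph_iso S (induced E S) T (induced F T)" "clique E S"
  shows "clique F T"
proof -
  obtain f where f: "bij_betw f S T"
    "\<And>u v. u \<in> S \<Longrightarrow> v \<in> S \<Longrightarrow> {u, v} \<in> induced E S \<longleftrightarrow> {f u, f v} \<in> induced F T"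
    using assms(1) by (auto simp: graph_iso_def)
  show ?thesis unfolding clique_def
  proof (intro ballI impI)
    fix x y assume "x \<in> T" "y \<in> T" "x \<noteq> y"
    then obtain u v where "u \<in> S" "v \<in> S" "x = f u" "y = f v" "u \<noteq> v"
      using f(1) by (auto simp: bij_betw_def)
    then show "{x, y} \<in> F" using f(2)[of u v] assms(2) by (auto simp: clique_def induced_def)
  qed
qed

lemma independent_transfer:
  assumes "graph_iso S (induced E S) T (induced F T)" "independent E S"
  shows "independent F T"
proof -
  obtain f where f: "bij_betw f S T"
    "\<And>u v. u \<in> S \<Longrightarrow> v \<in> S \<Longrightarrow> {u, v} \<in> induced E S \<longleftrightarrow> {f u, f v} \<in> induced F T"
    using assms(1) by (auto simp: graph_iso_def)
  show ?thesis unfolding independent_def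
  proof (intro ballI)
    fix x y assume xy: "x \<in> T" "y \<in> T"
    then obtain u v where "u \<in> S" "v \<in> S" "x = f u" "y = f v"
      using f(1) by (auto simp: bij_betw_def)
    then show "{x, y} \<notin> F" using f(2)[of u v] assms(2) xy by (auto simp: independent_def induced_def)
  qed
qed

text \<open>The equality case of an estimate of Erdos-Gallai type. Each vertex of \<open>A\<close>
  has at most three neighbours in \<open>A \<union> {w}\<close>, and the edges from \<open>A\<close>
  to \<open>B\<close> number at most the degree sum of \<open>B\<close>. Equality makes
  \<open>A \<union> {w}\<close> a clique and confines the neighbours of \<open>B\<close> to
  \<open>A\<close>.\<close>

lemma extremal_degree_sum_split:
  assumes G: "simple_graph V E" and part: "V = A \<union> B \<union> {w}" "A \<inter> B = {}" "w \<notin> A \<union> B"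
    and card: "card A = 3"
    and sum: "9 + (\<Sum>b\<in>B. degree E b) \<le> (\<Sum>a\<in>A. degree E a)"
  shows "clique E (insert w A)" "independent E (insert w B)" "neighbours E w = A"
proof -
  have fin: "finite A" "finite B" using G part(1) by (auto simp: simple_graph_def)
  note deg = degree_eq_card_neighbours[OF G]
  have split: "neighbours E a = (neighbours E a \<inter> insert w (A - {a})) \<union> (neighbours E a \<inter> B)" for a
    using neighbours_subset[OF G, of a] part(1) by auto
  have dega: "degree E a = card (neighbours E a \<inter> insert w (A - {a})) + card (neighbours E a \<inter> B)"
    if "a \<in> A" for a
  proof -
    have "card ((neighbours E a \<inter> insert w (A - {a})) \<union> (neighbours E a \<inter> B))
        = card (neighbours E a \<inter> insert w (A - {a})) + card (neighbours E a \<inter> B)"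
      by (rule card_Un_disjoint) (use fin part in auto)
    then show ?thesis using split[of a] deg by simp
  qed
  have card3: "card (insert w (A - {a})) = 3" if "a \<in> A" for a
    using that card part(3) fin by simp
  have le3: "card (neighbours E a \<inter> insert w (A - {a})) \<le> 3" if "a \<in> A" for a
    using card_mono[of "insert w (A - {a})" "neighbours E a \<inter> insert w (A - {a})"] card3[OF that] fin by simp
  have le: "degree E a \<le> 3 + card (neighbours E a \<inter> B)" if "a \<in> A" for a
    using dega[OF that] le3[OF that] by simp
  have leb: "card (neighbours E b \<inter> A) \<le> degree E b" for b
    unfolding deg by (rule card_mono) (use finite_neighbours[OF G] in auto)
  have 1: "(\<Sum>a\<in>A. degree E a) \<le> (\<Sum>a\<in>A. 3 + card (neighbours E a \<inter> B))"
    by (rule sum_mono) (rule le)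
  have 2: "(\<Sum>a\<in>A. 3 + card (neighbours E a \<inter> B)) = 9 + (\<Sum>b\<in>B. card (neighbours E b \<inter> A))"
    using card by (simp add: sum.distrib sum_card_neighbours_swap[OF fin])
  have 3: "(\<Sum>b\<in>B. card (neighbours E b \<inter> A)) \<le> (\<Sum>b\<in>B. degree E b)"
    by (rule sum_mono) (rule leb)
  have eqA: "(\<Sum>a\<in>A. degree E a) = (\<Sum>a\<in>A. 3 + card (neighbours E a \<inter> B))"
    and eqB: "(\<Sum>b\<in>B. card (neighbours E b \<inter> A)) = (\<Sum>b\<in>B. degree E b)"
    using sum 1 2 3 by linarith+
  \<comment> \<open>Equal sums with termwise inequality are termwise equal.\<close>
  have nA: "insert w (A - {a}) \<subseteq> neighbours E a" if a: "a \<in> A" for a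
  proof -
    have "degree E a = 3 + card (neighbours E a \<inter> B)"
      by (rule sum_mono_inv[OF eqA]) (use le a fin in auto)
    then have "card (neighbours E a \<inter> insert w (A - {a})) = card (insert w (A - {a}))"
      using dega[OF a] card3[OF a] by simp
    then have "neighbours E a \<inter> insert w (A - {a}) = insert w (A - {a})"
      using fin by (intro card_subset_eq) auto
    then show ?thesis by blast
  qed
  have nB: "neighbours E b \<subseteq> A" if b: "b \<in> B" for b
  proof -
    have "card (neighbours E b \<inter> A) = degree E b"
      by (rule sum_mono_inv[OF eqB]) (use leb b fin in auto)
    then have "neighbours E b \<inter> A = neighbours E b"
      unfolding deg using finite_neighbours[OF G] by (intro card_subset_eq) auto
    then show ?thesis by blast
  qed
  have wA: "A \<subseteq> neighbours E w" using nA neighbours_sym by fast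
  have "neighbours E w \<inter> B = {}" using nB part(3) neighbours_sym by fast
  then show nw: "neighbours E w = A" using wA neighbours_subset[OF G, of w] part(1) by auto
  show "clique E (insert w A)" unfolding clique_def
  proof (intro ballI impI)
    fix u v assume uv: "u \<in> insert w A" "v \<in> insert w A" "u \<noteq> v"
    then have "u \<in> neighbours E v" using nA[of v] wA by auto
    then show "{u, v} \<in> E" by (simp add: neighbours_def)
  qed
  show "independent E (insert w B)" unfolding independent_def
  proof (intro ballI)
    fix u v assume "u \<in> insert w B" "v \<in> insert w B"
    then have "u \<notin> neighbours E v" using nB[of v] nw part by auto
    then show "{u, v} \<notin> E" by (simp add: neighbours_def)
  qed
qed

text \<open>A clique and an independent set share at most one vertex. As 4 + 4 - 1 = 7, they share
  exactly one and cover \<open>V\<close>. Counting the edges between the two remaining triples gives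
  the degree sums.\<close>

lemma clique_independent_partition:
  assumes G: "simple_graph V E" "card V = 7"
    and K: "K \<subseteq> V" "card K = 4" "clique E K" and I: "I \<subseteq> V" "card I = 4" "independent E I"
  obtains A B w where "V = A \<union> B \<union> {w}" "A \<inter> B = {}" "w \<notin> A \<union> B" "card A = 3" "card B = 3"
    "degree E w = 3" "(\<Sum>a\<in>A. degree E a) = 9 + (\<Sum>b\<in>B. degree E b)"
proof -
  have fV: "finite V" using G by (simp add: simple_graph_def)
  then have fin: "finite K" "finite I" using K I finite_subset by auto
  note deg = degree_eq_card_neighbours[OF G(1)]
  have "card (K \<union> I) + card (K \<inter> I) = 8" using card_Un_Int[OF fin] K I by simp
  moreover have "card (K \<union> I) \<le> 7" using card_mono[OF fV, of "K \<union> I"] K I G by simp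
  moreover have "card (K \<inter> I) \<le> Suc 0"
    using K(3) I(3) fin by (subst card_le_Suc0_iff_eq) (auto simp: clique_def independent_def)
  ultimately have c: "card (K \<inter> I) = 1" "card (K \<union> I) = 7" by auto
  then obtain w where w: "K \<inter> I = {w}" by (auto simp: card_1_singleton_iff)
  have V: "V = K \<union> I" using card_subset_eq[OF fV, of "K \<union> I"] K I G c by auto
  define A B where "A = K - {w}" and "B = I - {w}"
  have K': "K = insert w A" and I': "I = insert w B" using w by (auto simp: A_def B_def)
  have wn: "w \<notin> A" "w \<notin> B" by (auto simp: A_def B_def)
  have AB: "A \<inter> B = {}" using w by (auto simp: A_def B_def)
  have cA: "card A = 3" and cB: "card B = 3" using K I K' I' wn fin by auto
  have fAB: "finite A" "finite B" using fin by (auto simp: A_def B_def)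
  have nK: "u \<in> neighbours E v" if "u \<in> K" "v \<in> K" "u \<noteq> v" for u v
    using that K(3) by (auto simp: clique_def neighbours_def)
  have nI: "u \<notin> neighbours E v" if "u \<in> I" "v \<in> I" for u v
    using that I(3) by (auto simp: independent_def neighbours_def)
  have "neighbours E w = A"
    using neighbours_subset[OF G(1), of w] nK[of _ w] nI[of _ w] V K' I' wn by auto
  then have dw: "degree E w = 3" using deg cA by simp
  have "degree E a = 3 + card (neighbours E a \<inter> B)" if a: "a \<in> A" for a
  proof -
    have "neighbours E a = insert w (A - {a}) \<union> (neighbours E a \<inter> B)"
      using neighbours_subset[OF G(1), of a] nK[of _ a] V K' I' a wn by auto
    moreover have "card (insert w (A - {a}) \<union> (neighbours E a \<inter> B)) = card (insert w (A - {a})) + card (neighbours E a \<inter> B)"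
      by (rule card_Un_disjoint) (use fAB AB wn in auto)
    moreover have "card (insert w (A - {a})) = 3" using a wn cA fAB by simp
    ultimately show ?thesis using deg by metis
  qed
  then have "(\<Sum>a\<in>A. degree E a) = 9 + (\<Sum>a\<in>A. card (neighbours E a \<inter> B))"
    using cA by (simp add: sum.distrib)
  also have "(\<Sum>a\<in>A. card (neighbours E a \<inter> B)) = (\<Sum>b\<in>B. card (neighbours E b \<inter> A))"
    by (rule sum_card_neighbours_swap[OF fAB])
  also have "\<dots> = (\<Sum>b\<in>B. degree E b)"
  proof (rule sum.cong[OF refl])
    fix b assume "b \<in> B"
    then have "neighbours E b \<inter> A = neighbours E b"
      using neighbours_subset[OF G(1), of b] nI[of _ b] V K' I' by auto
    then show "card (neighbours E b \<inter> A) = degree E b" using deg by simp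
  qed
  finally have "(\<Sum>a\<in>A. degree E a) = 9 + (\<Sum>b\<in>B. degree E b)" .
  moreover have "V = A \<union> B \<union> {w}" using V K' I' by auto
  ultimately show ?thesis using that[of A B w] AB wn cA cB dw by auto
qed

text \<open>Three degrees \<open>q + 3\<close> exceed three degrees \<open>q\<close> by 9 in total,
  which is the extremal case for \<open>F\<close>. The resulting clique and independent set are
  cards, hence occur in \<open>E\<close> as well.\<close>

lemma same_4_deck_partition:
  assumes G: "simple_graph V E" "card V = 7" and H: "simple_graph W F" "card W = 7"
    and deck: "deck 4 V E = deck 4 W F"
    and total: "(\<Sum>v\<in>V. degree E v) = (\<Sum>v\<in>W. degree F v)"
    and cnt: "3 \<le> count (degree_list W F) q" "3 \<le> count (degree_list W F) (q + 3)"
  obtains A B where "A \<subseteq> V" "B \<subseteq> V" "card A = 3" "card B = 3"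
    "(\<Sum>a\<in>A. degree E a) = 3 * q + 9" "(\<Sum>b\<in>B. degree E b) = 3 * q"
    "degree_list W F = {#q, q, q, q + 3, q + 3, q + 3, 3#}"
proof -
  have fW: "finite W" and fV: "finite V" using G H by (simp_all add: simple_graph_def)
  obtain A' where A': "A' \<subseteq> {v \<in> W. degree F v = q + 3}" "card A' = 3" "finite A'"
    using cnt(2) unfolding count_degree_list[OF fW] by (rule obtain_subset_with_card_n)
  obtain B' where B': "B' \<subseteq> {v \<in> W. degree F v = q}" "card B' = 3" "finite B'"
    using cnt(1) unfolding count_degree_list[OF fW] by (rule obtain_subset_with_card_n)
  have disj: "A' \<inter> B' = {}" using A'(1) B'(1) by fastforce
  have sub: "A' \<union> B' \<subseteq> W" using A' B' by auto
  have "card (W - (A' \<union> B')) = 1"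
    using sub A' B' disj H(2) by (simp add: card_Diff_subset card_Un_disjoint)
  then obtain w where w: "W - (A' \<union> B') = {w}" by (auto simp: card_1_singleton_iff)
  have part: "W = A' \<union> B' \<union> {w}" "w \<notin> A' \<union> B'" using w sub by auto
  have sA: "(\<Sum>a\<in>A'. degree F a) = 3 * q + 9" using A' by (simp add: subset_iff)
  have sB: "(\<Sum>b\<in>B'. degree F b) = 3 * q" using B' by (simp add: subset_iff)
  note sp = extremal_degree_sum_split[OF H(1) part(1) disj part(2) A'(2)]
  have cl: "clique F (insert w A')" and ind: "independent F (insert w B')" and nw: "neighbours F w = A'"
    using sp sA sB by simp_all
  have dw: "degree F w = 3" using nw A'(2) degree_eq_card_neighbours[OF H(1)] by simp
  have K: "insert w A' \<subseteq> W" "card (insert w A') = 4" and I: "insert w B' \<subseteq> W" "card (insert w B') = 4"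
    using part A' B' by auto
  obtain K' where K': "K' \<subseteq> V" "card K' = 4" "clique E K'"
    using deck_eq_iso_card[OF H(1) G(1) deck[symmetric] K] clique_transfer[OF _ cl] by metis
  obtain I' where I': "I' \<subseteq> V" "card I' = 4" "independent E I'"
    using deck_eq_iso_card[OF H(1) G(1) deck[symmetric] I] independent_transfer[OF _ ind] by metis
  obtain A B u where V: "V = A \<union> B \<union> {u}" "A \<inter> B = {}" "u \<notin> A \<union> B" and c: "card A = 3" "card B = 3"
    and du: "degree E u = 3" and s: "(\<Sum>a\<in>A. degree E a) = 9 + (\<Sum>b\<in>B. degree E b)"
    using clique_independent_partition[OF G K' I'] by metis
  have fAB: "finite A" "finite B" using V(1) fV by auto
  have "(\<Sum>v\<in>V. degree E v) = (\<Sum>a\<in>A. degree E a) + (\<Sum>b\<in>B. degree E b) + 3"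
    unfolding V(1) using V fAB du by (simp add: sum.union_disjoint)
  moreover have "(\<Sum>v\<in>W. degree F v) = (\<Sum>a\<in>A'. degree F a) + (\<Sum>b\<in>B'. degree F b) + 3"
    unfolding part(1) using part disj A' B' dw by (simp add: sum.union_disjoint)
  \<comment> \<open>Both degree totals are twice the sum over the independent triple plus 12, so
    these sums agree.\<close>
  ultimately have "(\<Sum>b\<in>B. degree E b) = 3 * q" using total s sA sB by simp
  moreover have "degree_list W F = {#q, q, q, q + 3, q + 3, q + 3, 3#}"
  proof -
    have "mset_set W = mset_set A' + mset_set B' + {#w#}"
      unfolding part(1) using part disj A' B' by (simp add: mset_set_Union)
    moreover have "image_mset (degree F) (mset_set A') = image_mset (\<lambda>_. q + 3) (mset_set A')"
      using A' by (intro image_mset_cong) auto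
    moreover have "image_mset (degree F) (mset_set B') = image_mset (\<lambda>_. q) (mset_set B')"
      using B' by (intro image_mset_cong) auto
    ultimately have "degree_list W F = replicate_mset 3 (q + 3) + replicate_mset 3 q + {#3#}"
      using A' B' dw by (simp add: degree_list_def image_mset_const_eq)
    then show ?thesis by (simp add: numeral_3_eq_3)
  qed
  ultimately show ?thesis using that[of A B] V c s by auto
qed

text \<open>Here the degree lists would be 6, 4, 4, 3, 3, 3, 1 and 5, 5, 5, 3, 2, 2, 2; in the lemma after that
  they are the ones of the complements.\<close>

lemma no_exceptional_pair_low:
  assumes G: "simple_graph V E" "card V = 7" and H: "simple_graph W F" "card W = 7"
    and deck: "deck 4 V E = deck 4 W F"
    and x: "\<And>d. d \<le> 6 \<Longrightarrow> int (count (degree_list V E) d) - int (count (degree_list W F) d) = [0, 1, -3, 2, 2, -3, 1] ! d"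
  shows False
proof -
  have G': "card V = Suc 6" and H': "card W = Suc 6" using G H by simp_all
  note x' = x[of 0] x[of 1] x[of 2] x[of 3] x[of 4] x[of 5] x[of 6]
  have "(\<Sum>v\<in>V. degree E v) = (\<Sum>v\<in>W. degree F v)"
    using sum_degree_count[OF G(1) G', of "\<lambda>d. d"] sum_degree_count[OF H(1) H', of "\<lambda>d. d"] x'
    by (simp add: atMost_nat_numeral)
  moreover have "3 \<le> count (degree_list W F) 2" "3 \<le> count (degree_list W F) (2 + 3)" using x' by simp_all
  ultimately obtain B where B: "B \<subseteq> V" "card B = 3" "(\<Sum>b\<in>B. degree E b) = 3 * 2"
    and W: "degree_list W F = {#2, 2, 2, 2 + 3, 2 + 3, 2 + 3, 3#}"
    using same_4_deck_partition[OF G H deck, of 2] by metis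
  have fV: "finite V" using G by (simp add: simple_graph_def)
  \<comment> \<open>Truncated subtraction measures how far degrees fall below 3. The only deficit in
    \<open>E\<close> is 2, from the vertex of degree 1, but three vertices of degree sum 6 need a
    deficit of at least 3.\<close>
  have "(\<Sum>v\<in>V. 3 - degree E v) = 2"
    using sum_degree_count[OF G(1) G', of "\<lambda>d. 3 - d"] x' by (simp add: W atMost_nat_numeral)
  moreover have "(\<Sum>v\<in>B. 3 - degree E v) \<le> (\<Sum>v\<in>V. 3 - degree E v)"
    using B(1) fV by (intro sum_mono2) auto
  moreover have "(\<Sum>v\<in>B. 3) \<le> (\<Sum>v\<in>B. (3 - degree E v) + degree E v)" by (rule sum_mono) simp
  ultimately show False using B by (simp add: sum.distrib)
qed

lemma no_exceptional_pair_high: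
  assumes G: "simple_graph V E" "card V = 7" and H: "simple_graph W F" "card W = 7"
    and deck: "deck 4 V E = deck 4 W F"
    and x: "\<And>d. d \<le> 6 \<Longrightarrow> int (count (degree_list V E) d) - int (count (degree_list W F) d) = [1, -3, 2, 2, -3, 1, 0] ! d"
  shows False
proof -
  have G': "card V = Suc 6" and H': "card W = Suc 6" using G H by simp_all
  note x' = x[of 0] x[of 1] x[of 2] x[of 3] x[of 4] x[of 5] x[of 6]
  have "(\<Sum>v\<in>V. degree E v) = (\<Sum>v\<in>W. degree F v)"
    using sum_degree_count[OF G(1) G', of "\<lambda>d. d"] sum_degree_count[OF H(1) H', of "\<lambda>d. d"] x'
    by (simp add: atMost_nat_numeral)
  moreover have "3 \<le> count (degree_list W F) 1" "3 \<le> count (degree_list W F) (1 + 3)" using x' by simp_all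
  ultimately obtain A where A: "A \<subseteq> V" "card A = 3" "(\<Sum>a\<in>A. degree E a) = 3 * 1 + 9"
    and W: "degree_list W F = {#1, 1, 1, 1 + 3, 1 + 3, 1 + 3, 3#}"
    using same_4_deck_partition[OF G H deck, of 1] by metis
  have fV: "finite V" using G by (simp add: simple_graph_def)
  \<comment> \<open>Dually, the only excess over 3 is 2, from the vertex of degree 5, but three
    vertices of degree sum 12 need at least 3.\<close>
  have "(\<Sum>v\<in>V. degree E v - 3) = 2"
    using sum_degree_count[OF G(1) G', of "\<lambda>d. d - 3"] x' by (simp add: W atMost_nat_numeral)
  moreover have "(\<Sum>v\<in>A. degree E v - 3) \<le> (\<Sum>v\<in>V. degree E v - 3)"
    using A(1) fV by (intro sum_mono2) auto
  moreover have "(\<Sum>v\<in>A. degree E v) \<le> (\<Sum>v\<in>A. (degree E v - 3) + 3)" by (rule sum_mono) simp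
  ultimately show False using A by (simp add: sum.distrib)
qed

text \<open>The end coordinates 1 force an isolated and a dominating vertex. The other graph enters
  only through its counts being nonnegative, hence an arbitrary multiset \<open>L\<close>.\<close>

lemma no_exceptional_pair_balanced:
  assumes G: "simple_graph V E" "card V = 7"
    and x: "\<And>d. d \<le> 6 \<Longrightarrow> int (count (degree_list V E) d) - int (count L d) = [1, -2, -1, 4, -1, -2, 1] ! d"
  shows False
proof -
  have "int (count (degree_list V E) 0) = int (count L 0) + 1"
    "int (count (degree_list V E) 6) = int (count L 6) + 1" using x[of 0] x[of 6] by simp_all
  then have "count (degree_list V E) 0 > 0" "count (degree_list V E) 6 > 0" by linarith+
  then show False using degree_zero_dominating_incompatible[OF G(1), of 6] G(2) by simp
qed

lemma seven_vertices_degree_list: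
  assumes G: "simple_graph V E" "card V = 7" and H: "simple_graph W F" "card W = 7"
    and deck: "deck 4 V E = deck 4 W F"
  shows "degree_list V E = degree_list W F"
proof -
  have G': "card V = Suc 6" and H': "card W = Suc 6" using G H by simp_all
  define x where "x d = int (count (degree_list V E) d) - int (count (degree_list W F) d)" for d
  have "annihilates 6 x"
    using deck_eq_annihilates[OF G(1) G' H(1) H'] deck by (simp add: x_def[abs_def])
  moreover have "(\<Sum>d\<le>6. \<bar>x d\<bar>) \<le> 14"
    using sum_abs_count_diff_le[OF G(1) G' H(1) H'] by (simp add: x_def)
  ultimately have cases: "[x 0, x 1, x 2, x 3, x 4, x 5, x 6] \<in>
    {[0, 0, 0, 0, 0, 0, 0],
     [0, 1, -3, 2, 2, -3, 1], [0, -1, 3, -2, -2, 3, -1],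
     [1, -3, 2, 2, -3, 1, 0], [-1, 3, -2, -2, 3, -1, 0],
     [1, -2, -1, 4, -1, -2, 1], [-1, 2, 1, -4, 1, 2, -1]}"
    by (rule annihilates_bounded_6)
  let ?xs = "[x 0, x 1, x 2, x 3, x 4, x 5, x 6]"
  have nth: "x d = L ! d" if "?xs = L" "d \<le> 6" for L d
  proof -
    have "d \<in> {0, 1, 2, 3, 4, 5, 6}" using that(2) by auto
    then show ?thesis unfolding that(1)[symmetric] by auto
  qed
  \<comment> \<open>Opposite vectors are handled by exchanging the two graphs.\<close>
  have neg: "int (count (degree_list W F) d) - int (count (degree_list V E) d) = map uminus L ! d"
    if "?xs = L" "d \<le> 6" for L d
  proof -
    have "length L = 7" using that(1) by auto
    then show ?thesis using nth[OF that] that(2) by (simp add: x_def)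
  qed
  show ?thesis
    using cases unfolding insert_iff empty_iff
  proof (elim disjE FalseE)
    assume L: "?xs = [0, 0, 0, 0, 0, 0, 0]"
    have "x d = 0" if "d \<le> 6" for d
    proof -
      have "d \<in> {0, 1, 2, 3, 4, 5, 6}" using that by auto
      then show ?thesis using nth[OF L that] by auto
    qed
    then show ?thesis by (intro degree_list_eqI[OF G(1) G' H(1) H']) (simp add: x_def)
  next
    assume L: "?xs = [0, 1, -3, 2, 2, -3, 1]"
    show ?thesis using no_exceptional_pair_low[OF G H deck] nth[OF L] by (simp add: x_def)
  next
    assume L: "?xs = [0, -1, 3, -2, -2, 3, -1]"
    show ?thesis using no_exceptional_pair_low[OF H G deck[symmetric]] neg[OF L] by (simp add: x_def)
  next
    assume L: "?xs = [1, -3, 2, 2, -3, 1, 0]"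
    show ?thesis using no_exceptional_pair_high[OF G H deck] nth[OF L] by (simp add: x_def)
  next
    assume L: "?xs = [-1, 3, -2, -2, 3, -1, 0]"
    show ?thesis using no_exceptional_pair_high[OF H G deck[symmetric]] neg[OF L] by (simp add: x_def)
  next
    assume L: "?xs = [1, -2, -1, 4, -1, -2, 1]"
    show ?thesis using no_exceptional_pair_balanced[OF G, where L = "degree_list W F"] nth[OF L] by (simp add: x_def)
  next
    assume L: "?xs = [-1, 2, 1, -4, 1, 2, -1]"
    show ?thesis using no_exceptional_pair_balanced[OF H, where L = "degree_list V E"] neg[OF L] by (simp add: x_def)
  qed
qed

section \<open>Sharpness\<close>

lemma three_set_complement_of_point:
  assumes "card X = 3" "u \<in> X" "v \<in> X" "u \<noteq> v"
  obtains w where "w \<in> X" "w \<noteq> u" "w \<noteq> v" "{u, v} = X - {w}"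
proof -
  have "finite X" using assms(1) card.infinite by fastforce
  then have "card (X - {u, v}) = 1" using assms by (simp add: card_Diff_subset)
  then obtain w where "X - {u, v} = {w}" by (auto simp: card_1_singleton_iff)
  then show ?thesis using assms that[of w] by auto
qed

lemma card_edges_three_vertices:
  assumes "simple_graph X D" "card X = 3"
  shows "card {v \<in> X. X - {v} \<in> D} = card D"
proof -
  have "bij_betw (\<lambda>v. X - {v}) {v \<in> X. X - {v} \<in> D} D"
  proof (rule bij_betwI')
    fix e assume e: "e \<in> D"
    then have "e \<subseteq> X" "card e = 2" using assms by (auto simp: simple_graph_def)
    then obtain u v where uv: "e = {u, v}" "u \<noteq> v" "u \<in> X" "v \<in> X" by (auto simp: card_2_iff)
    obtain w where "w \<in> X" "e = X - {w}"
      using three_set_complement_of_point[OF assms(2) uv(3,4,2)] uv(1) by metis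
    then show "\<exists>w\<in>{v \<in> X. X - {v} \<in> D}. e = X - {w}" using e by auto
  qed auto
  then show ?thesis by (simp add: bij_betw_same_card)
qed

text \<open>In a 3-set each pair is the complement of a point, so a graph amounts to a set of
  points. Any bijection matching these sets and their complements is an isomorphism.\<close>

lemma three_vertices_iso:
  assumes S: "simple_graph S E" "card S = 3" and T: "simple_graph T F" "card T = 3"
    and eq: "card E = card F"
  shows "graph_iso S E T F"
proof -
  define M where "M = {v \<in> S. S - {v} \<in> E}"
  define M' where "M' = {v \<in> T. T - {v} \<in> F}"
  have fin: "finite S" "finite T" using S T by (simp_all add: simple_graph_def)
  have sub: "M \<subseteq> S" "M' \<subseteq> T" by (auto simp: M_def M'_def)
  have fM: "finite M" "finite M'" using fin sub finite_subset by auto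
  have cM: "card M = card M'"
    using card_edges_three_vertices[OF S] card_edges_three_vertices[OF T] eq by (simp add: M_def M'_def)
  then have "card (S - M) = card (T - M')" using S T sub fM by (simp add: card_Diff_subset)
  then obtain g h where g: "bij_betw g M M'" and h: "bij_betw h (S - M) (T - M')"
    using cM fM fin finite_same_card_bij by (metis finite_Diff)
  define f where "f v = (if v \<in> M then g v else h v)" for v
  have "bij_betw f (M \<union> (S - M)) (M' \<union> (T - M'))"
    unfolding f_def by (rule bij_betw_disjoint_Un[OF g h]) auto
  then have f: "bij_betw f S T" using sub by (simp add: Un_absorb1)
  have fM: "f v \<in> M' \<longleftrightarrow> v \<in> M" if "v \<in> S" for v
    using g h that by (auto simp: f_def bij_betw_def)
  have "{u, v} \<in> E \<longleftrightarrow> {f u, f v} \<in> F" if uv: "u \<in> S" "v \<in> S" for u v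
  proof (cases "u = v")
    case True
    then show ?thesis using S T by (auto simp: simple_graph_def)
  next
    case False
    obtain w where w: "w \<in> S" "w \<noteq> u" "w \<noteq> v" "{u, v} = S - {w}"
      using three_set_complement_of_point[OF S(2) uv False] .
    have "{f u, f v} = f ` (S - {w})" using w(4) by (metis image_empty image_insert)
    also have "\<dots> = T - {f w}" using f w(1) by (auto simp: bij_betw_def inj_on_def)
    finally have "{f u, f v} = T - {f w}" .
    then show ?thesis using fM[OF w(1)] w f by (auto simp: M_def M'_def bij_betw_def)
  qed
  then show ?thesis using f by (auto simp: graph_iso_def)
qed

lemma deck_3_eqI:
  fixes V W :: "'a set"
  assumes G: "simple_graph V E" and H: "simple_graph W F"
    and eq: "image_mset (\<lambda>S. card (induced E S)) (mset_set (subsets_of_card 3 V))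
           = image_mset (\<lambda>S. card (induced F S)) (mset_set (subsets_of_card 3 W))"
  shows "deck 3 V E = deck 3 W F"
proof -
  define P where "P m SX \<longleftrightarrow> simple_graph (fst SX) (snd SX) \<and> card (fst SX) = 3 \<and> card (snd SX) = m"
    for m and SX :: "'a set \<times> 'a set set"
  \<comment> \<open>One representative for each number of edges. For unattained \<open>m\<close> the
    choice is arbitrary, but \<open>c\<close> is only evaluated at edge counts of actual
    cards.\<close>
  define r where "r m = (SOME SX. P m SX)" for m
  define c where "c m = iso_class (fst (r m)) (snd (r m))" for m
  have c: "iso_class S (induced D S) = c (card (induced D S))"
    if "simple_graph X D" "S \<subseteq> X" "card S = 3" for S X :: "'a set" and D
  proof -
    have S: "simple_graph S (induced D S)" using simple_graph_induced[OF that(1,2)] .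
    have "P (card (induced D S)) (S, induced D S)" using S that(3) by (simp add: P_def)
    then have "P (card (induced D S)) (r (card (induced D S)))" unfolding r_def by (rule someI)
    then show ?thesis
      unfolding c_def using S that(3) by (intro iso_class_eqI three_vertices_iso) (auto simp: P_def)
  qed
  have deck: "deck 3 X D = image_mset c (image_mset (\<lambda>S. card (induced D S)) (mset_set (subsets_of_card 3 X)))"
    if X: "simple_graph X D" for X :: "'a set" and D
  proof -
    have "finite (subsets_of_card 3 X)" using X by (simp add: simple_graph_def)
    then show ?thesis
      using c[OF X] by (auto simp: deck_def image_mset.compositionality intro!: image_mset_cong)
  qed
  show ?thesis using deck[OF G] deck[OF H] eq by simp
qed

text \<open>Turns the family of subsets into a list that can be evaluated.\<close>

lemma mset_set_subsets_of_card:
  assumes "distinct xs"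
  shows "mset_set (subsets_of_card k (set xs)) = mset (filter (\<lambda>S. card S = k) (map set (subseqs xs)))"
proof -
  have "subsets_of_card k (set xs) = set (filter (\<lambda>S. card S = k) (map set (subseqs xs)))"
    using subseqs_powset[of xs] by auto
  then show ?thesis
    using mset_set_set distinct_filter distinct_set_subseqs[OF assms] by metis
qed

text \<open>A 5-cycle with an isolated vertex, and the spider with legs of length 1, 2, 2.\<close>

lemma six_vertices_counterexample:
  fixes V :: "nat set"
  defines "V \<equiv> set [0, 1, 2, 3, 4, 5]"
    and "E \<equiv> {{0, 1}, {1, 2}, {2, 3}, {3, 4}, {0, 4}}"
    and "F \<equiv> {{0, 1}, {0, 2}, {2, 3}, {0, 4}, {4, 5}}"
  shows "simple_graph V E" "simple_graph V F" "card V = 6" "deck 3 V E = deck 3 V F"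
    "degree_list V E \<noteq> degree_list V F"
proof -
  show G: "simple_graph V E" and H: "simple_graph V F"
    by (auto simp: simple_graph_def V_def E_def F_def)
  show "card V = 6" by (simp add: V_def)
  show "deck 3 V E = deck 3 V F"
  proof (rule deck_3_eqI[OF G H])
    \<comment> \<open>Among the 20 triples of either graph, 5 span no edge, 10 span one and 5 span
      two.\<close>
    have "mset (map (\<lambda>S. card (induced E S)) (filter (\<lambda>S. card S = 3) (map set (subseqs [0, 1, 2, 3, 4, 5]))))
        = mset (map (\<lambda>S. card (induced F S)) (filter (\<lambda>S. card S = 3) (map set (subseqs [0, 1, 2, 3, 4, 5]))))"
      unfolding E_def F_def induced_def by code_simp
    then show "image_mset (\<lambda>S. card (induced E S)) (mset_set (subsets_of_card 3 V))
        = image_mset (\<lambda>S. card (induced F S)) (mset_set (subsets_of_card 3 V))"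
      unfolding V_def by (subst (1 2) mset_set_subsets_of_card) simp_all
  qed
  have "degree E 5 = 0" by (auto simp: degree_def E_def)
  then have "count (degree_list V E) 0 > 0" by (auto simp: degree_list_def V_def)
  moreover have "degree F v \<noteq> 0" if "v \<in> V" for v
  proof -
    have "\<exists>e\<in>F. v \<in> e" using that by (auto simp: V_def F_def)
    then show ?thesis by (auto simp: degree_def F_def)
  qed
  then have "count (degree_list V F) 0 = 0" by (auto simp: degree_list_def V_def count_eq_zero_iff)
  ultimately show "degree_list V E \<noteq> degree_list V F" by (metis less_irrefl)
qed

theorem theorem1p7:
  shows "(\<forall>(n::nat) (V::'a set) (E::'a set set) (W::'b set) (F::'b set set).
            n \<ge> 7 \<longrightarrow> simple_graph V E \<longrightarrow> simple_graph W F \<longrightarrow>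
            card V = n \<longrightarrow> card W = n \<longrightarrow>
            deck (n - 3) V E = deck (n - 3) W F \<longrightarrow>
            degree_list V E = degree_list W F)
         \<and> (\<exists>(V::nat set) (E::nat set set) (W::nat set) (F::nat set set).
            simple_graph V E \<and> simple_graph W F \<and> card V = 6 \<and> card W = 6 \<and>
            deck 3 V E = deck 3 W F \<and> degree_list V E \<noteq> degree_list W F)"
proof (intro conjI allI impI)
  fix n :: nat and V :: "'a set" and E and W :: "'b set" and F
  assume n: "7 \<le> n" and G: "simple_graph V E" "card V = n" and H: "simple_graph W F" "card W = n"
    and deck: "deck (n - 3) V E = deck (n - 3) W F"
  show "degree_list V E = degree_list W F"
  proof (cases "n = 7")
    case True
    then show ?thesis using seven_vertices_degree_list[of V E W F] G H deck by simp
  next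
    case False
    then show ?thesis using large_degree_list[OF _ G H deck] n by simp
  qed
next
  show "\<exists>(V::nat set) (E::nat set set) (W::nat set) (F::nat set set).
            simple_graph V E \<and> simple_graph W F \<and> card V = 6 \<and> card W = 6 \<and>
            deck 3 V E = deck 3 W F \<and> degree_list V E \<noteq> degree_list W F"
    using six_vertices_counterexample by blast
qed

end
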